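(* Let $\Sigma$ be a $C^2$ hypersurface of $\mathbb{H}^n$ invariant under the rotations about the $t$-axis, with constant mean curvature $H$ with respect to the unit normal $N$ specified in the context. Then its generating curve $\gamma=(x,t)$, parametrized by arc-length, with angle function $\sigma$, satisfies the following system of ordinary differential equations whenever $x>0$: $$( * )_H\quad\left\{\begin{aligned}x'&=\sin\sigma,\\ t'&=\cos\sigma,\\ \sigma'&=(2n-1)\,\frac{\cos^3\sigma}{x^3}+2(n-1)\,\frac{\sin^2\sigma\,\cos\sigma}{x}-2nH\,\frac{(x^2\sin^2\sigma+\cos^2\sigma)^{3/2}}{x^2}.\end{aligned}\right.$$ Moreover, this system has a first integral: the function $$\frac{x^{2n-1}\cos\sigma}{\sqrt{x^2\sin^2\sigma+\cos^2\sigma}}-Hx^{2n}$$ is constant along any solution $(x,t,\sigma)$ of $( * )_H$.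
   Context: $\mathbb{H}^n$ is $\mathbb{R}^{2n+1}\equiv\mathbb{C}^n\times\mathbb{R}$, with coordinates $[z,t]$, $z_k=x_k+iy_k$, and product $[z,t]*[z',t']=[z+z',t+t'+\mathrm{Im}(\sum_{i}z_i\overline{z}'_i)]$. Set $X_k=\partial_{x_k}+y_k\partial_t$, $Y_k=\partial_{y_k}-x_k\partial_t$ ($k=1,\dots,n$), $T=\partial_t$. The horizontal distribution is spanned by $\{X_k,Y_k\}$; $U_H$ denotes the projection of $U$ onto it. $g=\langle\cdot,\cdot\rangle$ is the Riemannian metric making $\{X_k,Y_k,T\}$ orthonormal, with Levi-Civita connection $D$. For a $C^2$ hypersurface $\Sigma$ with unit normal $N$ in $(\mathbb{H}^n,g)$, the singular set is $\Sigma_0=\{N_H=0\}$; on $\Sigma-\Sigma_0$ put $\nu_H=N_H/|N_H|$ and define the mean curvature $H$ by $-2nH=\mathrm{div}_\Sigma\,\nu_H$, where $\mathrm{div}_\Sigma U=\sum_{i=1}^{2n}\langle D_{e_i}U,e_i\rangle$ for any orthonormal basis $\{e_i\}$ of $T_p\Sigma$. Rotations about the $t$-axis are the Euclidean rotations of $\mathbb{R}^{2n+1}=\mathbb{R}^{2n}\times\mathbb{R}$ fixing the $t$-axis. The generating curve $\gamma(s)=(x(s),t(s))$, $s\in I$, of $\Sigma$ is the curve cut by $\Sigma$ in the half-plane $\{(x,t)=(x_1,t):x\ge0\}$, so that $\Sigma$ is parametrized by $\phi(s,\omega)=(x(s)\omega,t(s))$, $\omega=(\omega_k,\omega_{n+k})\in\mathbb{S}^{2n-1}\subset\mathbb{R}^n\times\mathbb{R}^n$.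 It is parametrized by Euclidean arc-length $s$, and $\sigma(s)$ is the angle between $\gamma'(s)$ and $\partial/\partial t$, so that $x'=\sin\sigma$ and $t'=\cos\sigma$. The unit normal $N$ to $\Sigma$ is the one whose coordinates with respect to $\{X_k,Y_k,T\}$ are $$\frac{(xx'\omega_{n+k}-t'\omega_k,\ -xx'\omega_k-t'\omega_{n+k},\ x')}{\sqrt{|\gamma'|^2+x^2(x')^2}}\qquad\text{whenever }x>0$$ (here $|\gamma'|$ is the Euclidean norm). *)

theory Defs
  imports "HOL-Analysis.Analysis"
begin

text \<open>
  The Heisenberg group of dimension \<open>2n + 1\<close> with \<open>n = CARD('n)\<close>, in the coordinates \<open>(z, t)\<close>.
  The component of \<open>z\<close> at \<open>Inl k\<close> is \<open>x\<^sub>k\<close>, and the one at \<open>Inr k\<close> is \<open>y\<^sub>k\<close>, that is, the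
  \<open>(n + k)\<close>-th coordinate. All tangent spaces are identified with the same vector space through
  the coordinate fields.
\<close>

type_synonym 'n heis = "(real ^ ('n + 'n)) \<times> real"

definition X_field :: "'n::finite \<Rightarrow> 'n heis \<Rightarrow> 'n heis" where
  "X_field k p = (axis (Inl k) 1, fst p $ Inr k)"

definition Y_field :: "'n::finite \<Rightarrow> 'n heis \<Rightarrow> 'n heis" where
  "Y_field k p = (axis (Inr k) 1, - (fst p $ Inl k))"

definition T_field :: "'n::finite heis \<Rightarrow> 'n heis" where
  "T_field p = (0, 1)"

text \<open>
  The coordinates of the tangent vector \<open>v\<close> at \<open>p\<close> with respect to the frame
  \<open>X\<^sub>k, Y\<^sub>k, T\<close>; see lemma \<open>frame_expansion\<close>.
\<close>

definition frame_coords :: "'n::finite heis \<Rightarrow> 'n heis \<Rightarrow> 'n heis" where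
  "frame_coords p v =
     (fst v, snd v - (\<Sum>k\<in>UNIV. fst v $ Inl k * fst p $ Inr k - fst v $ Inr k * fst p $ Inl k))"

definition metric :: "'n::finite heis \<Rightarrow> 'n heis \<Rightarrow> 'n heis \<Rightarrow> real" where
  "metric p u v = frame_coords p u \<bullet> frame_coords p v"

definition metric_norm :: "'n::finite heis \<Rightarrow> 'n heis \<Rightarrow> real" where
  "metric_norm p v = sqrt (metric p v v)"

lemma frame_expansion:
  "v = (\<Sum>k\<in>UNIV. (fst (frame_coords p v) $ Inl k) *\<^sub>R X_field k p)
     + (\<Sum>k\<in>UNIV. (fst (frame_coords p v) $ Inr k) *\<^sub>R Y_field k p)
     + snd (frame_coords p v) *\<^sub>R T_field p"
proof (rule prod_eqI)
  show "fst v = fst ((\<Sum>k\<in>UNIV. (fst (frame_coords p v) $ Inl k) *\<^sub>R X_field k p)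
     + (\<Sum>k\<in>UNIV. (fst (frame_coords p v) $ Inr k) *\<^sub>R Y_field k p)
     + snd (frame_coords p v) *\<^sub>R T_field p)" (is "_ = ?r")
  proof (rule vec_eq_iff[THEN iffD2], rule allI)
    fix i show "fst v $ i = ?r $ i"
      by (cases i) (auto simp: frame_coords_def X_field_def Y_field_def T_field_def fst_sum
          axis_def if_distrib cong: if_cong)
  qed
  show "snd v = snd ((\<Sum>k\<in>UNIV. (fst (frame_coords p v) $ Inl k) *\<^sub>R X_field k p)
     + (\<Sum>k\<in>UNIV. (fst (frame_coords p v) $ Inr k) *\<^sub>R Y_field k p)
     + snd (frame_coords p v) *\<^sub>R T_field p)"
    by (simp add: frame_coords_def X_field_def Y_field_def T_field_def snd_sum
        sum_subtractf sum_negf)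
qed

lemma frame_coords_frame:
  "frame_coords p (X_field k p) = (axis (Inl k) 1, 0)"
  "frame_coords p (Y_field k p) = (axis (Inr k) 1, 0)"
  "frame_coords p (T_field p) = (0, 1)"
  by (simp_all add: frame_coords_def X_field_def Y_field_def T_field_def axis_def
      if_distrib[of "\<lambda>a. a * _"] sum_negf cong: if_cong)

lemma metric_frame:
  "metric p (X_field k p) (X_field l p) = (if k = l then 1 else 0)"
  "metric p (Y_field k p) (Y_field l p) = (if k = l then 1 else 0)"
  "metric p (X_field k p) (Y_field l p) = 0"
  "metric p (X_field k p) (T_field p) = 0"
  "metric p (Y_field k p) (T_field p) = 0"
  "metric p (T_field p) (T_field p) = 1"
  by (simp_all add: metric_def frame_coords_frame inner_axis_axis)

definition horizontal_part :: "'n::finite heis \<Rightarrow> 'n heis \<Rightarrow> 'n heis" where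
  "horizontal_part p u =
     (\<Sum>k\<in>UNIV. metric p u (X_field k p) *\<^sub>R X_field k p)
   + (\<Sum>k\<in>UNIV. metric p u (Y_field k p) *\<^sub>R Y_field k p)"

text \<open>
  Every connection on a vector space is \<open>d + \<Gamma>\<close> with \<open>\<Gamma> p\<close> bilinear. The field \<open>U\<close> is
  differentiated within \<open>S\<close>: for \<open>S = UNIV\<close> this is the usual covariant derivative at \<open>p\<close> in the
  direction \<open>v\<close>, and for a hypersurface \<open>S\<close> and \<open>v\<close> tangent to \<open>S\<close> it only depends on the values
  of \<open>U\<close> on \<open>S\<close>.
\<close>

definition cov_deriv ::
    "('n::finite heis \<Rightarrow> 'n heis \<Rightarrow> 'n heis \<Rightarrow> 'n heis) \<Rightarrow> 'n heis set \<Rightarrow>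
     ('n heis \<Rightarrow> 'n heis) \<Rightarrow> 'n heis \<Rightarrow> 'n heis \<Rightarrow> 'n heis" where
  "cov_deriv \<Gamma> S U p v = frechet_derivative U (at p within S) v + \<Gamma> p v (U p)"

definition lie_bracket ::
    "('n::finite heis \<Rightarrow> 'n heis) \<Rightarrow> ('n heis \<Rightarrow> 'n heis) \<Rightarrow> 'n heis \<Rightarrow> 'n heis" where
  "lie_bracket U V p = frechet_derivative V (at p) (U p) - frechet_derivative U (at p) (V p)"

definition levi_civita :: "('n::finite heis \<Rightarrow> 'n heis \<Rightarrow> 'n heis \<Rightarrow> 'n heis) \<Rightarrow> bool" where
  "levi_civita \<Gamma> \<longleftrightarrow>
     (\<forall>p. bilinear (\<Gamma> p)) \<and>
     (\<forall>U V p. U differentiable (at p) \<longrightarrow> V differentiable (at p) \<longrightarrow>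
        cov_deriv \<Gamma> UNIV V p (U p) - cov_deriv \<Gamma> UNIV U p (V p) = lie_bracket U V p) \<and>
     (\<forall>U V p v. U differentiable (at p) \<longrightarrow> V differentiable (at p) \<longrightarrow>
        frechet_derivative (\<lambda>q. metric q (U q) (V q)) (at p) v =
          metric p (cov_deriv \<Gamma> UNIV U p v) (V p) + metric p (U p) (cov_deriv \<Gamma> UNIV V p v))"

definition christoffel :: "'n::finite heis \<Rightarrow> 'n heis \<Rightarrow> 'n heis \<Rightarrow> 'n heis" where
  "christoffel = (THE \<Gamma>. levi_civita \<Gamma>)"

text \<open>
  The description of \<open>christoffel\<close> as the unique torsion-free metric connection is legitimate: the
  following lemmas show that there is exactly one such connection, and compute it.
\<close>

definition Jrot :: "real ^ ('n + 'n) \<Rightarrow> real ^ ('n::finite + 'n)" where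
  "Jrot a = (\<chi> i. case i of Inl k \<Rightarrow> - (a $ Inr k) | Inr k \<Rightarrow> a $ Inl k)"

lemma linear_Jrot: "linear Jrot"
  by (rule linearI) (auto simp: Jrot_def vec_eq_iff split: sum.split)

lemma inner_Jrot:
  "Jrot a \<bullet> b = (\<Sum>k\<in>UNIV. a $ Inl k * b $ Inr k - a $ Inr k * b $ Inl k)"
proof -
  have "Jrot a \<bullet> b = (\<Sum>i\<in>UNIV <+> UNIV. Jrot a $ i * b $ i)"
    by (simp add: inner_vec_def UNIV_Plus_UNIV)
  also have "\<dots> = (\<Sum>k\<in>UNIV. - (a $ Inr k) * b $ Inl k) + (\<Sum>k\<in>UNIV. a $ Inl k * b $ Inr k)"
    by (subst sum.Plus) (simp_all add: Jrot_def)
  finally show ?thesis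
    by (simp add: sum_subtractf sum_negf)
qed

lemma Jrot_antisym: "Jrot a \<bullet> b = - (Jrot b \<bullet> a)"
  by (simp add: inner_Jrot sum_negf[symmetric] mult.commute)

lemma frame_coords_Jrot: "frame_coords p v = (fst v, snd v - Jrot (fst v) \<bullet> fst p)"
  by (simp add: frame_coords_def inner_Jrot)

lemma metric_Jrot:
  "metric p u v = fst u \<bullet> fst v + (snd u - Jrot (fst u) \<bullet> fst p) * (snd v - Jrot (fst v) \<bullet> fst p)"
  by (simp add: metric_def frame_coords_Jrot inner_prod_def)

lemma metric_simps:
  "metric p (u + u') v = metric p u v + metric p u' v"
  "metric p (u - u') v = metric p u v - metric p u' v"
  "metric p v (u + u') = metric p v u + metric p v u'"
  "metric p v (u - u') = metric p v u - metric p v u'"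
  by (simp_all add: metric_Jrot linear_add[OF linear_Jrot] linear_diff[OF linear_Jrot]
      inner_simps algebra_simps)

lemma metric_commute: "metric p u v = metric p v u"
  by (simp add: metric_def inner_commute)

lemma metric_self_eq_0_iff: "metric p u u = 0 \<longleftrightarrow> u = 0"
  unfolding metric_def inner_eq_zero_iff
  by (auto simp: frame_coords_Jrot prod_eq_iff linear_0[OF linear_Jrot])

definition heis_chr :: "'n::finite heis \<Rightarrow> 'n heis \<Rightarrow> 'n heis \<Rightarrow> 'n heis" where
  "heis_chr p v u =
    (let w = snd (frame_coords p v) *\<^sub>R Jrot (fst u) + snd (frame_coords p u) *\<^sub>R Jrot (fst v)
     in (w, Jrot w \<bullet> fst p))"

lemma fst_frame_coords: "fst (frame_coords p v) = fst v"
  by (simp add: frame_coords_def)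

lemma frame_coords_heis_chr:
  "frame_coords p (heis_chr p v u) =
     (snd (frame_coords p v) *\<^sub>R Jrot (fst u) + snd (frame_coords p u) *\<^sub>R Jrot (fst v), 0)"
  by (simp add: heis_chr_def Let_def frame_coords_Jrot)

lemma heis_chr_sym: "heis_chr p v u = heis_chr p u v"
  by (simp add: heis_chr_def add.commute)

lemma bilinear_heis_chr: "bilinear (heis_chr p)"
proof -
  have "linear (heis_chr p v)" for v
    by (rule linearI)
      (auto simp: heis_chr_def Let_def frame_coords_Jrot inner_simps algebra_simps
        linear_add[OF linear_Jrot] linear_diff[OF linear_Jrot] linear_cmul[OF linear_Jrot])
  then show ?thesis
    unfolding bilinear_def by (simp add: heis_chr_sym[of p _ y for y])
qed

lemma metric_has_derivative:
  assumes U: "(U has_derivative U') (at p)" and V: "(V has_derivative V') (at p)"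
  shows "((\<lambda>q. metric q (U q) (V q)) has_derivative
    (\<lambda>v. metric p (U' v + heis_chr p v (U p)) (V p)
       + metric p (U p) (V' v + heis_chr p v (V p)))) (at p)"
proof -
  have bl: "bounded_linear Jrot" by (simp add: linear_Jrot linear_conv_bounded_linear[symmetric])
  note [derivative_intros] = bounded_linear.has_derivative[OF bl]
  have 1: "metric p (heis_chr p v (U p)) (V p) + metric p (U p) (heis_chr p v (V p))
    = snd (frame_coords p (U p)) * (Jrot (fst v) \<bullet> fst (V p))
      + snd (frame_coords p (V p)) * (Jrot (fst v) \<bullet> fst (U p))" for v
  proof -
    have "Jrot (fst (U p)) \<bullet> fst (V p) = - (Jrot (fst (V p)) \<bullet> fst (U p))"
      by (rule Jrot_antisym)
    then show ?thesis
      by (simp add: metric_def frame_coords_heis_chr inner_prod_def inner_simps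
          fst_frame_coords inner_commute[of "fst (U p)"] algebra_simps)
  qed
  show ?thesis
    unfolding metric_simps(1,3) metric_Jrot[of _ "U _" "V _"]
    apply (rule derivative_eq_intros U V refl)+
    apply (rule ext)
    subgoal for v
      using 1[of v] Jrot_antisym[of "fst v" "fst (U p)"] Jrot_antisym[of "fst v" "fst (V p)"]
      by (simp add: metric_Jrot[of _ "U' _"] metric_Jrot[of _ _ "V' _"] frame_coords_Jrot
          algebra_simps)
    done
qed

lemma levi_civita_heis_chr: "levi_civita (heis_chr :: 'n::finite heis \<Rightarrow> _)"
  unfolding levi_civita_def
proof (intro conjI allI impI)
  fix p :: "'n heis" show "bilinear (heis_chr p)" by (rule bilinear_heis_chr)
next
  fix U V :: "'n heis \<Rightarrow> 'n heis" and p
  show "cov_deriv heis_chr UNIV V p (U p) - cov_deriv heis_chr UNIV U p (V p) = lie_bracket U V p"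
    by (simp add: cov_deriv_def lie_bracket_def heis_chr_sym[of p "V p"])
next
  fix U V :: "'n heis \<Rightarrow> 'n heis" and p v
  assume "U differentiable (at p)" "V differentiable (at p)"
  from metric_has_derivative[OF this[unfolded frechet_derivative_works]]
  show "frechet_derivative (\<lambda>q. metric q (U q) (V q)) (at p) v =
      metric p (cov_deriv heis_chr UNIV U p v) (V p)
      + metric p (U p) (cov_deriv heis_chr UNIV V p v)"
    by (simp add: cov_deriv_def frechet_derivative_at[symmetric])
qed

lemma levi_civita_unique:
  fixes G :: "'n::finite heis \<Rightarrow> _"
  assumes "levi_civita G" shows "G = heis_chr"
proof (intro ext)
  fix p v u :: "'n heis"
  define A where "A = (\<lambda>v u. G p v u - heis_chr p v u)"
  have con: "frechet_derivative (\<lambda>q. a) (at p) b = 0" for a b :: "'n heis"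
    using frechet_derivative_at[OF has_derivative_const[of a "at p"]] by (metis)
  have sym: "A a b = A b a" for a b
  proof -
    from assms have "cov_deriv G UNIV (\<lambda>_. b) p a - cov_deriv G UNIV (\<lambda>_. a) p b
      = lie_bracket (\<lambda>_. a) (\<lambda>_. b) p"
      unfolding levi_civita_def using differentiable_const by blast
    then have "G p a b = G p b a" by (simp add: cov_deriv_def lie_bracket_def con)
    then show ?thesis by (simp add: A_def heis_chr_sym[of p b])
  qed
  have comp: "L = G \<or> L = heis_chr \<Longrightarrow>
      frechet_derivative (\<lambda>q. metric q a b) (at p) c = metric p (L p c a) b + metric p a (L p c b)"
    for L and a b c :: "'n heis"
  proof -
    assume "L = G \<or> L = heis_chr"
    with assms levi_civita_heis_chr have "levi_civita L" by auto
    then have "frechet_derivative (\<lambda>q. metric q a b) (at p) c =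
       metric p (cov_deriv L UNIV (\<lambda>_. a) p c) b + metric p a (cov_deriv L UNIV (\<lambda>_. b) p c)"
      unfolding levi_civita_def using differentiable_const by blast
    then show ?thesis by (simp add: cov_deriv_def con)
  qed
  have anti: "metric p (A c a) b = - metric p (A c b) a" for a b c
    using comp[of G a b c] comp[of heis_chr a b c]
    by (simp add: A_def metric_simps metric_commute[of p a])
  have "metric p (A a b) c = 0" for a b c
    using anti[of a b c] anti[of b c a] anti[of c a b] sym[of a b] sym[of b c] sym[of c a] by simp
  then have "A v u = 0" by (metis metric_self_eq_0_iff)
  then show "G p v u = heis_chr p v u" by (simp add: A_def)
qed

lemma christoffel_eq: "christoffel = heis_chr"
  unfolding christoffel_def
  using levi_civita_heis_chr levi_civita_unique by (rule the_equality)

text \<open>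
  A \<open>C\<^sup>2\<close> hypersurface is locally a regular level set of a \<open>C\<^sup>2\<close> function \<open>F\<close>; here \<open>G\<close> is the
  Euclidean gradient of \<open>F\<close> and \<open>K\<close> the derivative of \<open>G\<close>.
\<close>

definition C2_hypersurface :: "'n::finite heis set \<Rightarrow> bool" where
  "C2_hypersurface S \<longleftrightarrow>
     (\<forall>p\<in>S. \<exists>W F G (K :: 'n heis \<Rightarrow> 'n heis \<Rightarrow>\<^sub>L 'n heis).
        open W \<and> p \<in> W \<and> S \<inter> W = {q\<in>W. F q = (0::real)} \<and>
        (\<forall>q\<in>W. (F has_derivative (\<lambda>h. G q \<bullet> h)) (at q)
             \<and> (G has_derivative blinfun_apply (K q)) (at q) \<and> G q \<noteq> 0) \<and>
        continuous_on W K)"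

definition tangent_space :: "'n::finite heis set \<Rightarrow> 'n heis \<Rightarrow> 'n heis set" where
  "tangent_space S p =
     {v. \<exists>c \<epsilon>. \<epsilon> > 0 \<and> c 0 = p \<and> (\<forall>r. \<bar>r\<bar> < \<epsilon> \<longrightarrow> c r \<in> S) \<and>
           (c has_vector_derivative v) (at (0::real))}"

definition unit_normal :: "'n::finite heis set \<Rightarrow> ('n heis \<Rightarrow> 'n heis) \<Rightarrow> bool" where
  "unit_normal S N \<longleftrightarrow> continuous_on S N \<and>
     (\<forall>p\<in>S. metric_norm p (N p) = 1 \<and> (\<forall>v\<in>tangent_space S p. metric p (N p) v = 0))"

definition singular_set :: "'n::finite heis set \<Rightarrow> ('n heis \<Rightarrow> 'n heis) \<Rightarrow> 'n heis set" where
  "singular_set S N = {p\<in>S. horizontal_part p (N p) = 0}"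

definition horizontal_normal :: "('n::finite heis \<Rightarrow> 'n heis) \<Rightarrow> 'n heis \<Rightarrow> 'n heis" where
  "horizontal_normal N p =
     (1 / metric_norm p (horizontal_part p (N p))) *\<^sub>R horizontal_part p (N p)"

definition tangent_onb :: "'n::finite heis set \<Rightarrow> 'n heis \<Rightarrow> 'n heis set \<Rightarrow> bool" where
  "tangent_onb S p B \<longleftrightarrow>
     span B = tangent_space S p \<and>
     (\<forall>u\<in>B. \<forall>v\<in>B. metric p u v = (if u = v then 1 else 0))"

text \<open>The common value over all orthonormal bases of the tangent space.\<close>

definition divergence :: "'n::finite heis set \<Rightarrow> ('n heis \<Rightarrow> 'n heis) \<Rightarrow> 'n heis \<Rightarrow> real" where
  "divergence S U p =
     (THE d. \<forall>B. tangent_onb S p B \<longrightarrow> d = (\<Sum>e\<in>B. metric p (cov_deriv christoffel S U p e) e))"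

definition mean_curvature :: "'n::finite heis set \<Rightarrow> ('n heis \<Rightarrow> 'n heis) \<Rightarrow> 'n heis \<Rightarrow> real" where
  "mean_curvature S N p = - divergence S (horizontal_normal N) p / (2 * real CARD('n))"

definition has_constant_mean_curvature ::
    "'n::finite heis set \<Rightarrow> ('n heis \<Rightarrow> 'n heis) \<Rightarrow> real \<Rightarrow> bool" where
  "has_constant_mean_curvature S N H \<longleftrightarrow> (\<forall>p\<in>S - singular_set S N. mean_curvature S N p = H)"

definition rotation_invariant :: "'n::finite heis set \<Rightarrow> bool" where
  "rotation_invariant S \<longleftrightarrow>
     (\<forall>R :: real ^ ('n + 'n) \<Rightarrow> real ^ ('n + 'n).
        orthogonal_transformation R \<and> det (matrix R) = 1 \<longrightarrow> (\<lambda>(z, \<tau>). (R z, \<tau>)) ` S = S)"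

text \<open>
  The index \<open>k\<close> plays the role of the first one: the half-plane is that of the points whose only
  possibly nonzero coordinates are \<open>x\<^sub>k \<ge> 0\<close> and \<open>t\<close>. The functions \<open>dx\<close>, \<open>dt\<close> are the
  derivatives of \<open>x\<close>, \<open>t\<close>, one-sided at those endpoints of \<open>I\<close> which belong to \<open>I\<close>.
\<close>

definition half_plane :: "'n::finite \<Rightarrow> 'n heis set" where
  "half_plane k = {(r *\<^sub>R axis (Inl k) 1, \<tau>) | r \<tau>. r \<ge> 0}"

definition generating_curve ::
    "'n::finite \<Rightarrow> 'n heis set \<Rightarrow> real set \<Rightarrow> (real \<Rightarrow> real) \<Rightarrow> (real \<Rightarrow> real) \<Rightarrow>
     (real \<Rightarrow> real) \<Rightarrow> (real \<Rightarrow> real) \<Rightarrow> bool" where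
  "generating_curve k S I x t dx dt \<longleftrightarrow>
     is_interval I \<and>
     (\<lambda>s. (x s *\<^sub>R axis (Inl k) 1, t s)) ` I = S \<inter> half_plane k \<and>
     (\<forall>s\<in>I. (x has_real_derivative dx s) (at s within I)
          \<and> (t has_real_derivative dt s) (at s within I)
          \<and> (dx s)\<^sup>2 + (dt s)\<^sup>2 = 1)"

text \<open>The angle is a continuous determination along the curve.\<close>

definition angle_function ::
    "real set \<Rightarrow> (real \<Rightarrow> real) \<Rightarrow> (real \<Rightarrow> real) \<Rightarrow> (real \<Rightarrow> real) \<Rightarrow> bool" where
  "angle_function I dx dt \<sigma> \<longleftrightarrow>
     continuous_on I \<sigma> \<and> (\<forall>s\<in>I. dx s = sin (\<sigma> s) \<and> dt s = cos (\<sigma> s))"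

definition has_profile_normal ::
    "('n::finite heis \<Rightarrow> 'n heis) \<Rightarrow> real set \<Rightarrow> (real \<Rightarrow> real) \<Rightarrow> (real \<Rightarrow> real) \<Rightarrow>
     (real \<Rightarrow> real) \<Rightarrow> (real \<Rightarrow> real) \<Rightarrow> bool" where
  "has_profile_normal N I x t dx dt \<longleftrightarrow>
     (\<forall>s\<in>I. x s > 0 \<longrightarrow> (\<forall>\<omega> :: real ^ ('n + 'n). norm \<omega> = 1 \<longrightarrow>
        (let p = (x s *\<^sub>R \<omega>, t s) in
         N p = (1 / sqrt ((dx s)\<^sup>2 + (dt s)\<^sup>2 + (x s)\<^sup>2 * (dx s)\<^sup>2)) *\<^sub>R
           ((\<Sum>k\<in>UNIV. (x s * dx s * \<omega> $ Inr k - dt s * \<omega> $ Inl k) *\<^sub>R X_field k p)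
          + (\<Sum>k\<in>UNIV. (- (x s * dx s * \<omega> $ Inl k) - dt s * \<omega> $ Inr k) *\<^sub>R Y_field k p)
          + dx s *\<^sub>R T_field p))))"

definition cmc_system_at ::
    "nat \<Rightarrow> real \<Rightarrow> real set \<Rightarrow> (real \<Rightarrow> real) \<Rightarrow> (real \<Rightarrow> real) \<Rightarrow> (real \<Rightarrow> real) \<Rightarrow> real \<Rightarrow> bool" where
  "cmc_system_at n H I x t \<sigma> s \<longleftrightarrow>
     (x has_real_derivative sin (\<sigma> s)) (at s within I) \<and>
     (t has_real_derivative cos (\<sigma> s)) (at s within I) \<and>
     (\<sigma> has_real_derivative
        (2 * real n - 1) * (cos (\<sigma> s) ^ 3 / x s ^ 3)
        + 2 * (real n - 1) * ((sin (\<sigma> s))\<^sup>2 * cos (\<sigma> s) / x s)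
        - 2 * real n * H *
            (((x s)\<^sup>2 * (sin (\<sigma> s))\<^sup>2 + (cos (\<sigma> s))\<^sup>2) powr (3 / 2) / (x s)\<^sup>2))
       (at s within I)"

end

theory Submission
  imports Defs
begin

text \<open>
  Let \<open>J\<close> be the complex structure \<open>Jrot\<close> and \<open>z = r \<omega>\<close>. With the angle \<open>\<theta>\<close> of the generating curve regarded as a
  function of \<open>(r, \<tau>)\<close>, the horizontal normal is
  \<open>\<nu> = - (sin \<theta> J z + (cos \<theta> / r) z) / \<rho>\<close>, where \<open>\<rho>\<^sup>2 = r\<^sup>2 sin\<^sup>2 \<theta> + cos\<^sup>2 \<theta>\<close>, that
  is, \<open>\<rho> = horizontal_length r \<theta>\<close>. This formula makes sense on an open set of the
  ambient space, where it defines a horizontal unit field \<open>V\<close>, so the divergence of \<open>\<nu>\<close> along the hypersurface is the full divergence of \<open>V\<close> minus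
  \<open>\<langle>D\<^sub>N V, N\<rangle>\<close>. The latter term vanishes: \<open>N\<close> is a combination of \<open>V\<close> and \<open>T\<close>, and
  \<open>D\<^sub>N V\<close> is orthogonal to \<open>V\<close> (a unit field) and to \<open>T\<close> (because \<open>D\<^sub>N T\<close> is a multiple of \<open>J V\<close>); see
  \<open>normal_term_zero\<close>. The Levi-Civita connection contributes nothing to the trace, so that \<open>- 2 n H\<close>
  is the Euclidean divergence of \<open>V\<close>. Computing it (\<open>profile_field_trace\<close>), the derivatives of \<open>\<theta>\<close>
  enter only through \<open>\<theta>\<^sub>r sin \<theta> + \<theta>\<^sub>\<tau> cos \<theta>\<close>, which is the derivative of the angle along the
  generating curve. Solving for it gives the third equation of the system (\<open>sigma_rhs_iff\<close>).

  Two points need care. First, the angle has to be shown to extend to a differentiable function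
  \<open>\<theta>\<close>, and in particular to be differentiable itself. A defining function of the hypersurface has a
  differentiable gradient \<open>G\<close>; the gradient is orthogonal to the orbits of the rotations and to the
  curve, hence determines the tangent line of the curve, and the continuity of \<open>N\<close> fixes its
  orientation (\<open>angle_field_exists\<close>). Second, the tangent space is swept out by curves that run along
  the generating curve in both directions (\<open>tangent_space_at_profile\<close>). This works over interior
  parameters only; at an endpoint the equation follows from the mean value theorem
  (\<open>derivative_extends_to_interval\<close>).

  The first integral is a direct computation: its derivative is a multiple of the difference of the
  two sides of the third equation.
\<close>

section \<open>The ordinary differential equation and its first integral\<close>

text \<open>
  The length of the horizontal part of the normal vector of the profile before it is normalized, at
  distance \<open>r\<close> from the axis, if the generating curve makes the angle \<open>a\<close> with the axis.
\<close>

definition horizontal_length :: "real \<Rightarrow> real \<Rightarrow> real" where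
  "horizontal_length r a = sqrt (r\<^sup>2 * (sin a)\<^sup>2 + (cos a)\<^sup>2)"

lemma horizontal_length_sq: "(horizontal_length r a)\<^sup>2 = r\<^sup>2 * (sin a)\<^sup>2 + (cos a)\<^sup>2"
  by (simp add: horizontal_length_def)

lemma horizontal_length_pos: "r \<noteq> 0 \<Longrightarrow> horizontal_length r a > 0"
proof -
  assume "r \<noteq> 0"
  then have "r\<^sup>2 * (sin a)\<^sup>2 + (cos a)\<^sup>2 \<noteq> 0"
    using sin_cos_squared_add[of a] by (smt (verit) add_nonneg_eq_0_iff mult_eq_0_iff zero_eq_power2 zero_le_mult_iff zero_le_power2)
  moreover have "r\<^sup>2 * (sin a)\<^sup>2 + (cos a)\<^sup>2 \<ge> 0" by simp
  ultimately have "r\<^sup>2 * (sin a)\<^sup>2 + (cos a)\<^sup>2 > 0" by linarith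
  then show ?thesis by (simp only: horizontal_length_def real_sqrt_gt_zero)
qed

lemma horizontal_length_powr: "(r\<^sup>2 * (sin a)\<^sup>2 + (cos a)\<^sup>2) powr (3/2) = horizontal_length r a ^ 3" if "r \<noteq> 0"
proof -
  have "(r\<^sup>2 * (sin a)\<^sup>2 + (cos a)\<^sup>2) powr (3/2) = ((horizontal_length r a) powr 2) powr (3/2)"
    using horizontal_length_pos[OF that, of a] by (simp add: horizontal_length_sq)
  also have "\<dots> = horizontal_length r a powr 3" by (simp add: powr_powr)
  finally show ?thesis using horizontal_length_pos[OF that, of a] by simp
qed

lemma has_derivative_horizontal_length:
  assumes x: "(x has_real_derivative x') (at s within I)"
    and a: "(a has_real_derivative a') (at s within I)" and "x s \<noteq> 0"
  shows "((\<lambda>s. horizontal_length (x s) (a s)) has_real_derivative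
    (x s * x' * (sin (a s))\<^sup>2 + ((x s)\<^sup>2 - 1) * sin (a s) * cos (a s) * a') / horizontal_length (x s) (a s))
    (at s within I)"
proof -
  have "0 < (x s)\<^sup>2 * (sin (a s))\<^sup>2 + (cos (a s))\<^sup>2"
    using horizontal_length_pos[OF \<open>x s \<noteq> 0\<close>, of "a s"] by (simp add: horizontal_length_def)
  then show ?thesis
    unfolding horizontal_length_def
    by (auto intro!: derivative_eq_intros x a simp: field_simps power2_eq_square)
qed

text \<open>
  This quotient is the radial component of the horizontal normal, up to sign. Its derivative collapses
  because the partial derivative of \<open>cos a / \<rho>\<close> in \<open>a\<close> is \<open>- r\<^sup>2 sin a / \<rho>\<^sup>3\<close>. The formula serves
  twice: for the radial derivative in the divergence and for the first integral.
\<close>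

lemma has_derivative_cos_horizontal_length:
  assumes x: "(x has_real_derivative x') (at s within I)"
    and a: "(a has_real_derivative a') (at s within I)" and x0: "x s \<noteq> 0"
  shows "((\<lambda>s. cos (a s) / horizontal_length (x s) (a s)) has_real_derivative
    - ((x s)\<^sup>2 * sin (a s) * a' + x s * x' * (sin (a s))\<^sup>2 * cos (a s)) / horizontal_length (x s) (a s) ^ 3)
    (at s within I)"
proof -
  define v where "v = horizontal_length (x s) (a s)"
  have v: "v > 0" using horizontal_length_pos[OF x0] by (simp add: v_def)
  have c2: "(sin (a s))\<^sup>2 = 1 - (cos (a s))\<^sup>2" by (simp add: sin_squared_eq)
  have v2: "v\<^sup>2 = (x s)\<^sup>2 * (sin (a s))\<^sup>2 + (cos (a s))\<^sup>2" by (simp add: v_def horizontal_length_sq)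
  have "(- sin (a s) * a' * v - cos (a s) * ((x s * x' * (sin (a s))\<^sup>2 + ((x s)\<^sup>2 - 1) * sin (a s) * cos (a s) * a') / v))
      / (v * v)
    = (- sin (a s) * a' * v\<^sup>2 - cos (a s) * (x s * x' * (sin (a s))\<^sup>2 + ((x s)\<^sup>2 - 1) * sin (a s) * cos (a s) * a')) / v ^ 3"
    using v by (simp add: field_simps power2_eq_square power3_eq_cube)
  also have "\<dots> = - ((x s)\<^sup>2 * sin (a s) * a' + x s * x' * (sin (a s))\<^sup>2 * cos (a s)) / v ^ 3"
    unfolding v2 c2 by (simp add: algebra_simps power2_eq_square)
  finally show ?thesis
    using v unfolding v_def
    by (auto intro!: derivative_eq_intros has_derivative_horizontal_length[OF x a x0] a)
qed

lemma has_derivative_sin_horizontal_length: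
  assumes a: "(a has_real_derivative a') (at s within I)" and r: "r \<noteq> 0"
  shows "((\<lambda>s. sin (a s) / horizontal_length r (a s)) has_real_derivative cos (a s) * a' / horizontal_length r (a s) ^ 3)
    (at s within I)"
proof -
  define v where "v = horizontal_length r (a s)"
  have v: "v > 0" using horizontal_length_pos[OF r] by (simp add: v_def)
  have c2: "(sin (a s))\<^sup>2 = 1 - (cos (a s))\<^sup>2" by (simp add: sin_squared_eq)
  have v2: "v\<^sup>2 = r\<^sup>2 * (sin (a s))\<^sup>2 + (cos (a s))\<^sup>2" by (simp add: v_def horizontal_length_sq)
  have "(cos (a s) * a' * v - sin (a s) * ((r * 0 * (sin (a s))\<^sup>2 + (r\<^sup>2 - 1) * sin (a s) * cos (a s) * a') / v))
      / (v * v)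
    = (cos (a s) * a' * v\<^sup>2 - (sin (a s))\<^sup>2 * ((r\<^sup>2 - 1) * cos (a s) * a')) / v ^ 3"
    using v by (simp add: field_simps power2_eq_square power3_eq_cube)
  also have "\<dots> = cos (a s) * a' / v ^ 3"
    unfolding v2 c2 by (simp add: algebra_simps power2_eq_square)
  finally show ?thesis
    using v unfolding v_def
    by (auto intro!: derivative_eq_intros has_derivative_horizontal_length[OF DERIV_const a r] a)
qed

definition sigma_rhs :: "nat \<Rightarrow> real \<Rightarrow> real \<Rightarrow> real \<Rightarrow> real" where
  "sigma_rhs n H r a = (2 * real n - 1) * (cos a ^ 3 / r ^ 3)
        + 2 * (real n - 1) * ((sin a)\<^sup>2 * cos a / r)
        - 2 * real n * H * ((r\<^sup>2 * (sin a)\<^sup>2 + (cos a)\<^sup>2) powr (3 / 2) / r\<^sup>2)"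

text \<open>
  Multiplying the third equation by \<open>r\<^sup>2 / \<rho>\<^sup>3\<close> puts it in the form in which the mean curvature
  produces it: with \<open>a'\<close> the derivative of the angle along the
  curve, the left-hand side of the second equation is the divergence of the horizontal normal.
\<close>

lemma sigma_rhs_iff:
  assumes r: "r > 0"
  shows "a' = sigma_rhs n H r a \<longleftrightarrow>
    r\<^sup>2 * a' / horizontal_length r a ^ 3 + r * (sin a)\<^sup>2 * cos a / horizontal_length r a ^ 3
      - (2 * real n - 1) * cos a / (r * horizontal_length r a) = - 2 * real n * H"
    (is "?l \<longleftrightarrow> ?r")
proof -
  define v where "v = horizontal_length r a"
  have v: "v > 0" using horizontal_length_pos r by (simp add: v_def)
  have v2: "v\<^sup>2 = r\<^sup>2 * (sin a)\<^sup>2 + (cos a)\<^sup>2" by (simp add: v_def horizontal_length_sq)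
  have "sigma_rhs n H r a =
      (2 * real n - 1) * cos a * v\<^sup>2 / r ^ 3 - (sin a)\<^sup>2 * cos a / r - 2 * real n * H * (v ^ 3 / r\<^sup>2)"
    using r unfolding sigma_rhs_def horizontal_length_powr[OF less_imp_neq[OF r, symmetric]] v2
    by (simp add: v_def field_simps power2_eq_square power3_eq_cube)
  also have "\<dots> = (v ^ 3 / r\<^sup>2) *
      ((2 * real n - 1) * cos a / (r * v) - r * (sin a)\<^sup>2 * cos a / v ^ 3 - 2 * real n * H)"
    using r v by (simp add: field_simps power2_eq_square power3_eq_cube)
  finally have R: "sigma_rhs n H r a = (v ^ 3 / r\<^sup>2) *
      ((2 * real n - 1) * cos a / (r * v) - r * (sin a)\<^sup>2 * cos a / v ^ 3 - 2 * real n * H)" .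
  have "a' = (v ^ 3 / r\<^sup>2) * c \<longleftrightarrow> r\<^sup>2 * a' / v ^ 3 = c" for c
    using r v by (auto simp: field_simps)
  with R have "?l \<longleftrightarrow> r\<^sup>2 * a' / v ^ 3 =
      (2 * real n - 1) * cos a / (r * v) - r * (sin a)\<^sup>2 * cos a / v ^ 3 - 2 * real n * H"
    by simp
  also have "\<dots> \<longleftrightarrow> ?r" unfolding v_def by linarith
  finally show ?thesis .
qed

lemma cmc_system_at_iff:
  "cmc_system_at n H I x t \<sigma> s \<longleftrightarrow>
     (x has_real_derivative sin (\<sigma> s)) (at s within I) \<and>
     (t has_real_derivative cos (\<sigma> s)) (at s within I) \<and>
     (\<sigma> has_real_derivative sigma_rhs n H (x s) (\<sigma> s)) (at s within I)"
  by (simp add: cmc_system_at_def sigma_rhs_def)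

lemma first_integral:
  assumes n: "n \<ge> 1" and J: "is_interval J"
    and sol: "\<And>s. s \<in> J \<Longrightarrow> x s > 0 \<and> cmc_system_at n H J x t \<sigma> s"
  shows "(\<lambda>s. x s ^ (2 * n - 1) * cos (\<sigma> s)
               / sqrt ((x s)\<^sup>2 * (sin (\<sigma> s))\<^sup>2 + (cos (\<sigma> s))\<^sup>2)
             - H * x s ^ (2 * n)) constant_on J"
proof -
  have "((\<lambda>s. x s ^ (2 * n - 1) * (cos (\<sigma> s) / horizontal_length (x s) (\<sigma> s)) - H * x s ^ (2 * n))
      has_real_derivative 0) (at s within J)" if s: "s \<in> J" for s
  proof -
    have r: "x s > 0" and x: "(x has_real_derivative sin (\<sigma> s)) (at s within J)"
      and \<sigma>: "(\<sigma> has_real_derivative sigma_rhs n H (x s) (\<sigma> s)) (at s within J)"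
      using sol[OF s] by (auto simp: cmc_system_at_iff)
    define v where "v = horizontal_length (x s) (\<sigma> s)"
    define a' where "a' = sigma_rhs n H (x s) (\<sigma> s)"
    have v: "v > 0" using horizontal_length_pos r by (simp add: v_def)
    obtain m where m: "n = Suc m" using n by (cases n) auto
    have E: "(x s)\<^sup>2 * a' / v ^ 3 + x s * (sin (\<sigma> s))\<^sup>2 * cos (\<sigma> s) / v ^ 3
      - (2 * real n - 1) * cos (\<sigma> s) / (x s * v) = - 2 * real n * H"
      using sigma_rhs_iff[OF r] a'_def unfolding v_def by blast
    have "(2 * real n - 1) * x s ^ (2 * m) * sin (\<sigma> s) * (cos (\<sigma> s) / v)
      + x s ^ (2 * m + 1) * (- ((x s)\<^sup>2 * sin (\<sigma> s) * a'
           + x s * sin (\<sigma> s) * (sin (\<sigma> s))\<^sup>2 * cos (\<sigma> s)) / v ^ 3)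
      - H * (2 * real n * x s ^ (2 * m + 1) * sin (\<sigma> s))
      = x s ^ (2 * m + 1) * sin (\<sigma> s) * (- 2 * real n * H - ((x s)\<^sup>2 * a' / v ^ 3
          + x s * (sin (\<sigma> s))\<^sup>2 * cos (\<sigma> s) / v ^ 3
          - (2 * real n - 1) * cos (\<sigma> s) / (x s * v)))"
    proof -
      have "x s * q * u * ((2 * real n - 1) * c / (x s * v)) = (2 * real n - 1) * q * u * (c / v)" for q u c
        using r by simp
      from this[of "x s ^ (2 * m)" "sin (\<sigma> s)" "cos (\<sigma> s)"] show ?thesis
        by (simp add: right_diff_distrib distrib_left add_divide_distrib diff_divide_distrib power2_eq_square mult_ac)
    qed
    also have "\<dots> = 0" unfolding E by simp
    finally have z: "(2 * real n - 1) * x s ^ (2 * m) * sin (\<sigma> s) * (cos (\<sigma> s) / v)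
      + x s ^ (2 * m + 1) * (- ((x s)\<^sup>2 * sin (\<sigma> s) * a'
           + x s * sin (\<sigma> s) * (sin (\<sigma> s))\<^sup>2 * cos (\<sigma> s)) / v ^ 3)
      - H * (2 * real n * x s ^ (2 * m + 1) * sin (\<sigma> s)) = 0" .
    have p1: "((\<lambda>s. x s ^ (2 * n - 1)) has_real_derivative (2 * real n - 1) * x s ^ (2 * m) * sin (\<sigma> s)) (at s within J)"
      using DERIV_power[OF x, of "2 * n - 1"] by (simp add: m algebra_simps)
    have p2: "((\<lambda>s. x s ^ (2 * n)) has_real_derivative 2 * real n * x s ^ (2 * m + 1) * sin (\<sigma> s)) (at s within J)"
      using DERIV_power[OF x, of "2 * n"] by (simp add: m algebra_simps)
    have e: "2 * n - 1 = 2 * m + 1" by (simp add: m)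
    show ?thesis
    proof (rule DERIV_cong[OF DERIV_diff[OF DERIV_mult[OF p1
            has_derivative_cos_horizontal_length[OF x \<sigma> less_imp_neq[OF r, symmetric]]] DERIV_cmult[OF p2]]])
      show "(2 * real n - 1) * x s ^ (2 * m) * sin (\<sigma> s) * (cos (\<sigma> s) / horizontal_length (x s) (\<sigma> s))
        + - ((x s)\<^sup>2 * sin (\<sigma> s) * sigma_rhs n H (x s) (\<sigma> s)
            + x s * sin (\<sigma> s) * (sin (\<sigma> s))\<^sup>2 * cos (\<sigma> s)) / horizontal_length (x s) (\<sigma> s) ^ 3 * x s ^ (2 * n - 1)
        - H * (2 * real n * x s ^ (2 * m + 1) * sin (\<sigma> s)) = 0"
        using z unfolding v_def a'_def e by (simp only: mult.commute)
    qed
  qed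
  from has_field_derivative_zero_constant[OF is_interval_convex[OF J] this] show ?thesis
    by (simp add: constant_on_def horizontal_length_def)
qed

text \<open>
  By the mean value theorem the difference quotients at \<open>s0\<close> are values of \<open>g\<close> at interior points near
  \<open>s0\<close>. If \<open>s0\<close> belongs to the boundary, this yields the one-sided derivative.
\<close>

lemma derivative_extends_to_interval:
  fixes f g :: "real \<Rightarrow> real"
  assumes I: "is_interval I" and s0: "s0 \<in> I" and f: "continuous_on I f"
    and g: "continuous (at s0 within I) g"
    and D: "\<forall>\<^sub>F s in at s0. s \<in> interior I \<longrightarrow> (f has_real_derivative g s) (at s)"
  shows "(f has_real_derivative g s0) (at s0 within I)"
proof -
  have key: "\<exists>\<xi>\<in>I. \<bar>\<xi> - s0\<bar> < d \<and> (f y - f s0) / (y - s0) = g \<xi>"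
    if d: "d > 0" "\<And>s. s \<in> interior I \<Longrightarrow> s \<noteq> s0 \<Longrightarrow> \<bar>s - s0\<bar> < d \<Longrightarrow> (f has_real_derivative g s) (at s)"
      and y: "y \<in> I" "y \<noteq> s0" "\<bar>y - s0\<bar> < d" for d y
  proof -
    define a b where "a = min y s0" and "b = max y s0"
    have ab: "a < b" "a \<in> I" "b \<in> I" using y s0 by (auto simp: a_def b_def min_def max_def)
    have sub: "{a..b} \<subseteq> I" using mem_is_interval_1_I[OF I ab(2,3)] by auto
    have int: "{a<..<b} \<subseteq> interior I"
      by (rule interior_maximal) (use sub in auto)
    have near: "\<bar>s - s0\<bar> < d" "s \<noteq> s0" if "s \<in> {a<..<b}" for s
      using that y by (auto simp: a_def b_def min_def max_def split: if_splits)
    have "(f has_derivative (\<lambda>h. g s * h)) (at s)" if "a < s" "s < b" for s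
      using d(2)[of s] int near[of s] that by (auto simp: has_field_derivative_def)
    from mvt[OF ab(1) continuous_on_subset[OF f sub] this]
    have "\<exists>\<xi>. a < \<xi> \<and> \<xi> < b \<and> f b - f a = g \<xi> * (b - a)" by metis
    then obtain \<xi> where \<xi>: "a < \<xi>" "\<xi> < b" "f b - f a = g \<xi> * (b - a)" by blast
    have "(f y - f s0) / (y - s0) = g \<xi>"
    proof (cases "y < s0")
      case True
      then have "a = y" "b = s0" by (simp_all add: a_def b_def)
      with \<xi>(3) have "f y - f s0 = g \<xi> * (y - s0)" by (simp add: algebra_simps)
      then show ?thesis using y by simp
    next
      case False
      then have "a = s0" "b = y" by (simp_all add: a_def b_def)
      with \<xi>(3) y show ?thesis by simp
    qed
    with \<xi> near[of \<xi>] sub show ?thesis by (intro bexI[of _ \<xi>]) auto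
  qed
  show ?thesis
    unfolding has_field_derivative_iff
  proof (rule tendstoI)
    fix e :: real assume "e > 0"
    with g obtain d1 where d1: "d1 > 0" "\<And>s. s \<in> I \<Longrightarrow> dist s s0 < d1 \<Longrightarrow> dist (g s) (g s0) < e"
      unfolding continuous_within_eps_delta by metis
    from D obtain d2 where d2: "d2 > 0"
      "\<And>s. s \<noteq> s0 \<Longrightarrow> dist s s0 < d2 \<Longrightarrow> s \<in> interior I \<longrightarrow> (f has_real_derivative g s) (at s)"
      unfolding eventually_at by auto
    have "dist ((f y - f s0) / (y - s0)) (g s0) < e" if "y \<in> I" "y \<noteq> s0" "dist y s0 < min d1 d2" for y
      using key[of "min d1 d2" y] that d1 d2 by (force simp: dist_real_def)
    then show "\<forall>\<^sub>F y in at s0 within I. dist ((f y - f s0) / (y - s0)) (g s0) < e"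
      unfolding eventually_at using d1(1) d2(1) by (intro exI[of _ "min d1 d2"]) auto
  qed
qed

section \<open>Orthonormal frames and the divergence along a hypersurface\<close>

lemma Jrot_Jrot: "Jrot (Jrot a) = - a"
  by (auto simp: Jrot_def vec_eq_iff split: sum.split)

lemma inner_Jrot_self: "Jrot a \<bullet> a = 0"
  using Jrot_antisym[of a a] by simp

lemma inner_Jrot_Jrot: "Jrot a \<bullet> Jrot b = a \<bullet> b"
  using Jrot_antisym[of a "Jrot b"] by (simp add: Jrot_Jrot inner_commute)

lemmas Jrot_linear = linear_add[OF linear_Jrot] linear_diff[OF linear_Jrot]
  linear_cmul[OF linear_Jrot] linear_neg[OF linear_Jrot] linear_0[OF linear_Jrot]

text \<open>
  The inverse of \<open>frame_coords p\<close>: the tangent vector with given coordinates in the frame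
  \<open>X\<^sub>k, Y\<^sub>k, T\<close>.
\<close>

definition of_frame :: "'n::finite heis \<Rightarrow> 'n heis \<Rightarrow> 'n heis" where
  "of_frame p y = (fst y, snd y + Jrot (fst y) \<bullet> fst p)"

lemma frame_coords_of_frame [simp]: "frame_coords p (of_frame p y) = y"
  by (simp add: of_frame_def frame_coords_Jrot)

lemma of_frame_frame_coords [simp]: "of_frame p (frame_coords p v) = v"
  by (simp add: of_frame_def frame_coords_Jrot)

lemma fst_of_frame [simp]: "fst (of_frame p y) = fst y"
  by (simp add: of_frame_def)

lemma linear_frame_coords: "linear (frame_coords p)"
  by (rule linearI) (simp_all add: frame_coords_Jrot Jrot_linear inner_simps algebra_simps)

lemma linear_of_frame: "linear (of_frame p)"
  by (rule linearI) (simp_all add: of_frame_def Jrot_linear inner_simps algebra_simps)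

lemma frame_sum:
  "(\<Sum>k\<in>UNIV. (h $ Inl k) *\<^sub>R X_field k p) + (\<Sum>k\<in>UNIV. (h $ Inr k) *\<^sub>R Y_field k p)
     + c *\<^sub>R T_field p = of_frame p (h, c)"
  using frame_expansion[of "of_frame p (h, c)" p] by simp

lemma horizontal_part_eq: "horizontal_part p u = of_frame p (fst u, 0)"
proof -
  have "metric p u (X_field k p) = fst u $ Inl k" "metric p u (Y_field k p) = fst u $ Inr k" for k
    by (simp_all add: metric_def frame_coords_frame inner_axis fst_frame_coords inner_prod_def)
  then show ?thesis
    using frame_sum[of "fst u" p 0] by (simp add: horizontal_part_def)
qed

lemma horizontal_normal_eq:
  "horizontal_normal N q = of_frame q ((1 / norm (fst (N q))) *\<^sub>R fst (N q), 0)"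
  by (simp add: horizontal_normal_def horizontal_part_eq metric_norm_def metric_def
      norm_eq_sqrt_inner linear_cmul[OF linear_of_frame, symmetric])

lemma singular_set_iff: "p \<in> singular_set S N \<longleftrightarrow> p \<in> S \<and> fst (N p) = 0"
  by (auto simp: singular_set_def horizontal_part_eq of_frame_def prod_eq_iff Jrot_linear)

lemma orthonormal_finite:
  fixes B :: "'a::euclidean_space set"
  assumes "\<forall>u\<in>B. \<forall>v\<in>B. u \<bullet> v = (if u = v then 1 else 0)"
  shows "finite B" and "independent B"
proof -
  have "0 \<notin> B" using assms by force
  moreover have "pairwise orthogonal B" using assms by (auto simp: pairwise_def orthogonal_def)
  ultimately show "independent B" by (metis pairwise_orthogonal_independent)
  then show "finite B" by (rule independent_imp_finite)
qed

lemma orthonormal_parseval: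
  fixes B :: "'a::euclidean_space set"
  assumes on: "\<forall>u\<in>B. \<forall>v\<in>B. u \<bullet> v = (if u = v then 1 else 0)" and x: "x \<in> span B"
  shows "(\<Sum>b\<in>B. (x \<bullet> b) * (y \<bullet> b)) = x \<bullet> y"
proof -
  note fin = orthonormal_finite(1)[OF on]
  \<comment> \<open>The error of the orthogonal projection lies in the span and is orthogonal to it.\<close>
  define w where "w = x - (\<Sum>b\<in>B. (x \<bullet> b) *\<^sub>R b)"
  have wb: "w \<bullet> b = 0" if "b \<in> B" for b
  proof -
    have "(\<Sum>c\<in>B. (x \<bullet> c) *\<^sub>R c) \<bullet> b = (\<Sum>c\<in>B. if c = b then x \<bullet> c else 0)"
      unfolding inner_sum_left by (rule sum.cong) (use on that in auto)
    then show ?thesis using fin that by (simp add: w_def inner_diff_left)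
  qed
  have "w \<in> span B"
    unfolding w_def by (intro span_diff x span_sum span_scale span_base)
  then have "orthogonal w w"
    using orthogonal_to_span[of w B w] wb by (auto simp: orthogonal_def)
  then have "x = (\<Sum>b\<in>B. (x \<bullet> b) *\<^sub>R b)" by (simp add: w_def orthogonal_self)
  then have "x \<bullet> y = (\<Sum>b\<in>B. (x \<bullet> b) *\<^sub>R b) \<bullet> y" by (rule arg_cong)
  also have "\<dots> = (\<Sum>b\<in>B. (x \<bullet> b) * (b \<bullet> y))" by (simp add: inner_sum_left)
  finally show ?thesis by (simp add: inner_commute[of y])
qed

lemma trace_orthonormal:
  fixes M :: "'a::euclidean_space \<Rightarrow> 'a"
  assumes M: "linear M" and on: "\<forall>u\<in>B. \<forall>v\<in>B. u \<bullet> v = (if u = v then 1 else 0)"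
    and sp: "span B = UNIV"
  shows "(\<Sum>b\<in>B. M b \<bullet> b) = (\<Sum>i\<in>Basis. M i \<bullet> i)"
proof -
  have "(\<Sum>b\<in>B. M b \<bullet> b) = (\<Sum>b\<in>B. \<Sum>i\<in>Basis. (b \<bullet> i) * (M i \<bullet> b))"
  proof (rule sum.cong[OF refl])
    fix b assume "b \<in> B"
    have "M b = M (\<Sum>i\<in>Basis. (b \<bullet> i) *\<^sub>R i)" by (simp add: euclidean_representation)
    also have "\<dots> = (\<Sum>i\<in>Basis. (b \<bullet> i) *\<^sub>R M i)"
      by (simp add: linear_sum[OF M] linear_cmul[OF M])
    finally show "M b \<bullet> b = (\<Sum>i\<in>Basis. (b \<bullet> i) * (M i \<bullet> b))" by (simp add: inner_sum_left)
  qed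
  also have "\<dots> = (\<Sum>i\<in>Basis. \<Sum>b\<in>B. (i \<bullet> b) * (M i \<bullet> b))"
    by (subst sum.swap) (simp add: inner_commute)
  also have "\<dots> = (\<Sum>i\<in>Basis. M i \<bullet> i)"
    by (intro sum.cong refl, subst orthonormal_parseval[OF on]) (simp_all add: sp inner_commute)
  finally show ?thesis .
qed

text \<open>
  Adding the normal \<open>n\<close> to an orthonormal basis of the hyperplane gives one of the whole space. Hence
  the trace over the hyperplane does not depend on the basis, as the definition of the divergence
  presupposes.
\<close>

lemma trace_orthonormal_hyperplane:
  fixes M :: "'a::euclidean_space \<Rightarrow> 'a"
  assumes M: "linear M" and on: "\<forall>u\<in>B. \<forall>v\<in>B. u \<bullet> v = (if u = v then 1 else 0)"
    and sp: "span B = {v. n \<bullet> v = 0}" and n: "n \<bullet> n = 1"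
  shows "(\<Sum>b\<in>B. M b \<bullet> b) = (\<Sum>i\<in>Basis. M i \<bullet> i) - M n \<bullet> n"
proof -
  have nB: "n \<bullet> b = 0" if "b \<in> B" for b
    using that sp span_superset[of B] by auto
  then have nB': "b \<bullet> n = 0" if "b \<in> B" for b using that by (simp add: inner_commute)
  from nB have "n \<notin> B" using n by auto
  have "span (insert n B) = UNIV"
  proof -
    have "v \<in> span (insert n B)" for v
    proof -
      have "v - (n \<bullet> v) *\<^sub>R n \<in> span B" using n by (simp add: sp inner_diff_right)
      then show ?thesis unfolding span_insert by blast
    qed
    then show ?thesis by auto
  qed
  moreover have "\<forall>u\<in>insert n B. \<forall>v\<in>insert n B. u \<bullet> v = (if u = v then 1 else 0)"
    using on n nB nB' \<open>n \<notin> B\<close> by auto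
  ultimately have "(\<Sum>b\<in>insert n B. M b \<bullet> b) = (\<Sum>i\<in>Basis. M i \<bullet> i)"
    by (intro trace_orthonormal[OF M]) auto
  then show ?thesis
    using \<open>n \<notin> B\<close> orthonormal_finite(1)[OF on] by simp
qed

lemma tangent_onb_frame:
  assumes "tangent_space S p = {v. metric p n v = 0}"
  shows "tangent_onb S p B \<longleftrightarrow> span (frame_coords p ` B) = {y. frame_coords p n \<bullet> y = 0} \<and>
     (\<forall>u\<in>frame_coords p ` B. \<forall>v\<in>frame_coords p ` B. u \<bullet> v = (if u = v then 1 else 0))"
proof -
  have inj: "inj (frame_coords p)" by (rule inj_on_inverseI[of _ "of_frame p"]) simp
  have im: "{y. frame_coords p n \<bullet> y = 0} = frame_coords p ` {v. metric p n v = 0}"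
  proof (intro equalityI subsetI)
    fix y assume "y \<in> {y. frame_coords p n \<bullet> y = 0}"
    then show "y \<in> frame_coords p ` {v. metric p n v = 0}"
      by (intro image_eqI[of _ _ "of_frame p y"]) (simp_all add: metric_def)
  qed (auto simp: metric_def)
  have "span B = {v. metric p n v = 0} \<longleftrightarrow>
      span (frame_coords p ` B) = {y. frame_coords p n \<bullet> y = 0}"
    unfolding im linear_span_image[OF linear_frame_coords] inj_image_eq_iff[OF inj] ..
  moreover have "(\<forall>u\<in>B. \<forall>v\<in>B. metric p u v = (if u = v then 1 else 0)) \<longleftrightarrow>
      (\<forall>u\<in>frame_coords p ` B. \<forall>v\<in>frame_coords p ` B. u \<bullet> v = (if u = v then 1 else 0))"
    unfolding metric_def ball_simps inj_eq[OF inj] ..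
  ultimately show ?thesis by (simp only: tangent_onb_def assms)
qed

text \<open>
  Derivatives within a hypersurface are not unique, so \<open>frechet_derivative\<close> picks an arbitrary one. On
  tangent vectors all choices agree, by the chain rule along a curve in \<open>S\<close>.
\<close>

lemma has_derivative_within_tangent_unique:
  assumes D: "(U has_derivative D) (at p within S)" "(U has_derivative D') (at p within S)"
    and v: "v \<in> tangent_space S p"
  shows "D v = D' v"
proof -
  obtain c e where c: "e > 0" "c 0 = p" "\<forall>r. \<bar>r\<bar> < e \<longrightarrow> c r \<in> S"
    "(c has_vector_derivative v) (at (0::real))"
    using v by (auto simp: tangent_space_def)
  define J where "J = {-e<..<e}"
  have at: "at 0 within J = at 0" using c(1) by (intro at_within_open) (auto simp: J_def)
  have cd: "(c has_derivative (\<lambda>h. h *\<^sub>R v)) (at 0 within J)"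
    using c(4) by (simp add: at has_vector_derivative_def)
  have J: "c ` J \<subseteq> S" using c(3) by (auto simp: J_def)
  have "((U \<circ> c) has_derivative (E \<circ> (\<lambda>h. h *\<^sub>R v))) (at 0)" if "(U has_derivative E) (at p within S)" for E
    using diff_chain_within[OF cd, of U E] has_derivative_subset[OF that J] c(2) by (simp add: at)
  from has_derivative_unique[OF this[OF D(1)] this[OF D(2)]]
  have "(D \<circ> (\<lambda>h. h *\<^sub>R v)) 1 = (D' \<circ> (\<lambda>h. h *\<^sub>R v)) 1" by simp
  then show ?thesis by simp
qed

text \<open>
  If a field on \<open>S\<close> extends to a differentiable field \<open>V\<close> nearby, then its divergence along \<open>S\<close> is the
  trace of \<open>D V\<close> over the whole space minus the normal term.
\<close>

lemma divergence_eq_trace: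
  fixes S :: "'n::finite heis set"
  assumes p: "p \<in> S" and tan: "tangent_space S p = {v. metric p n v = 0}" and n: "metric p n n = 1"
    and V: "(V has_derivative V') (at p)" and W: "open W" "p \<in> W"
    and UV: "\<And>q. q \<in> S \<Longrightarrow> q \<in> W \<Longrightarrow> U q = V q"
  shows "divergence S U p =
    (\<Sum>b\<in>Basis. frame_coords p (V' (of_frame p b) + heis_chr p (of_frame p b) (V p)) \<bullet> b)
      - metric p (V' n + heis_chr p n (V p)) n"
proof -
  define L where "L v = V' v + heis_chr p v (V p)" for v
  define M where "M y = frame_coords p (L (of_frame p y))" for y
  have "linear V'" using V by (rule has_derivative_linear)
  moreover have "linear (\<lambda>v. heis_chr p v (V p))"
    by (rule bilinear_heis_chr[unfolded bilinear_def, THEN conjunct2, rule_format])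
  ultimately have L: "linear L" unfolding L_def by (rule linear_compose_add)
  have M: "linear M"
    using linear_compose[OF linear_compose[OF linear_of_frame L] linear_frame_coords]
    unfolding M_def comp_def by simp
  have Up: "U p = V p" using UV p W by blast
  have UD: "(U has_derivative V') (at p within S)"
  proof (rule has_derivative_transform_eventually[OF has_derivative_at_withinI[OF V]])
    show "\<forall>\<^sub>F q in at p within S. V q = U q"
      unfolding eventually_at_topological using W UV by (intro exI[of _ W]) simp
  qed (simp_all add: p Up)
  have cov: "cov_deriv christoffel S U p e = L e" if "e \<in> tangent_space S p" for e
  proof -
    have "(U has_derivative frechet_derivative U (at p within S)) (at p within S)"
      using differentiableI[OF UD] by (simp only: frechet_derivative_works)
    from has_derivative_within_tangent_unique[OF this UD that]
    show ?thesis by (simp add: cov_deriv_def christoffel_eq L_def Up)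
  qed
  define d where "d = (\<Sum>b\<in>Basis. M b \<bullet> b) - metric p (L n) n"
  have inj: "inj_on (frame_coords p) B" for B by (rule inj_on_inverseI[of _ "of_frame p"]) simp
  have sum: "(\<Sum>e\<in>B. metric p (cov_deriv christoffel S U p e) e) = d" if B: "tangent_onb S p B" for B
  proof -
    have "e \<in> tangent_space S p" if "e \<in> B" for e
      using B that span_superset[of B] by (auto simp: tangent_onb_def)
    then have "(\<Sum>e\<in>B. metric p (cov_deriv christoffel S U p e) e) = (\<Sum>e\<in>B. metric p (L e) e)"
      by (intro sum.cong) (simp_all add: cov)
    also have "\<dots> = (\<Sum>y\<in>frame_coords p ` B. M y \<bullet> y)"
      by (subst sum.reindex[OF inj]) (simp add: M_def metric_def)
    also have "\<dots> = d"
    proof -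
      have "frame_coords p n \<bullet> frame_coords p n = 1" using n by (simp add: metric_def)
      from trace_orthonormal_hyperplane[OF M _ _ this, of "frame_coords p ` B"] B
      show ?thesis
        unfolding tangent_onb_frame[OF tan] by (simp add: d_def metric_def M_def)
    qed
    finally show ?thesis .
  qed
  have ex: "\<exists>B. tangent_onb S p B"
  proof -
    define T where "T = {y. frame_coords p n \<bullet> y = 0}"
    have "subspace T" unfolding T_def by (rule subspace_hyperplane)
    then obtain B where B: "B \<subseteq> T" "pairwise orthogonal B" "\<And>x. x \<in> B \<Longrightarrow> norm x = 1" "span B = T"
      by (rule orthonormal_basis_subspace) blast
    have "frame_coords p ` of_frame p ` B = B" by (simp add: image_image)
    with B have "tangent_onb S p (of_frame p ` B)"
      unfolding tangent_onb_frame[OF tan] T_def[symmetric]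
      by (auto simp: pairwise_def orthogonal_def norm_eq_1)
    then show ?thesis ..
  qed
  have "divergence S U p = d"
    unfolding divergence_def
  proof (rule the_equality)
    show "\<forall>B. tangent_onb S p B \<longrightarrow> d = (\<Sum>e\<in>B. metric p (cov_deriv christoffel S U p e) e)"
      using sum by simp
    show "d' = d" if "\<forall>B. tangent_onb S p B \<longrightarrow> d' = (\<Sum>e\<in>B. metric p (cov_deriv christoffel S U p e) e)" for d'
      using that ex sum by metis
  qed
  then show ?thesis unfolding d_def M_def L_def .
qed

text \<open>
  Differentiating \<open>\<langle>V, V\<rangle> = 1\<close> and \<open>\<langle>V, T\<rangle> = 0\<close> in the direction \<open>n\<close> shows that \<open>D\<^sub>n V\<close> is
  orthogonal to \<open>V\<close> and that its \<open>T\<close>-component is \<open>- \<langle>V, D\<^sub>n T\<rangle>\<close>. The latter vanishes because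
  the horizontal part of \<open>n\<close> is parallel to \<open>V\<close>, so that \<open>D\<^sub>n T\<close>, its image under \<open>J\<close>, is
  orthogonal to \<open>V\<close>.
\<close>

lemma normal_term_zero:
  fixes V :: "'n::finite heis \<Rightarrow> 'n heis"
  assumes V: "(V has_derivative V') (at p)" and W: "open W" "p \<in> W"
    and V1: "\<And>q. q \<in> W \<Longrightarrow> metric q (V q) (V q) = 1"
    and VT: "\<And>q. q \<in> W \<Longrightarrow> metric q (V q) (0, 1) = 0"
    and n: "fst n = \<alpha> *\<^sub>R fst (V p)"
  shows "metric p (V' n + heis_chr p n (V p)) n = 0"
proof -
  have const: "D = (\<lambda>_. 0)" if "(f has_derivative D) (at p)" "\<And>q. q \<in> W \<Longrightarrow> f q = c"
    for f :: "'n heis \<Rightarrow> real" and D c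
    using has_derivative_unique[OF that(1) has_derivative_transform_within_open[OF has_derivative_const W]]
      that(2) by metis
  define L where "L = V' n + heis_chr p n (V p)"
  have 1: "metric p L (V p) = 0"
    using fun_cong[OF const[OF metric_has_derivative[OF V V] V1], of n]
    by (simp add: L_def metric_commute[of p "V p"])
  have "metric p L (0, 1) + metric p (V p) (heis_chr p n (0, 1)) = 0"
    using fun_cong[OF const[OF metric_has_derivative[OF V has_derivative_const[of "(0, 1)"]] VT], of n]
    by (simp add: L_def)
  moreover have "metric p (V p) (heis_chr p n (0, 1)) = 0"
    unfolding metric_def frame_coords_heis_chr
    by (simp add: inner_prod_def fst_frame_coords frame_coords_Jrot[of _ "(0,1)"] Jrot_linear n
        inner_commute[of "fst (V p)"] inner_Jrot_self)
  ultimately have 2: "metric p L (0, 1) = 0" by simp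
  have V0: "snd (frame_coords p (V p)) = 0"
    using VT[OF W(2)] by (simp add: metric_def frame_coords_Jrot inner_prod_def Jrot_linear)
  have "metric p L n = \<alpha> * metric p L (V p) + snd (frame_coords p n) * metric p L (0, 1)"
    using V0 by (simp add: metric_def inner_prod_def fst_frame_coords n frame_coords_Jrot[of _ "(0,1)"] Jrot_linear)
  then show ?thesis using 1 2 by (simp add: L_def)
qed

text \<open>
  For horizontal \<open>u\<close> the Christoffel terms have trace zero, since they vanish on \<open>X\<^sub>k, Y\<^sub>k\<close> and take
  \<open>T\<close> to a horizontal vector; what remains is the trace of \<open>V'\<close> in the frame \<open>X\<^sub>k, Y\<^sub>k, T\<close>.
\<close>

lemma trace_frame:
  fixes V' :: "'n::finite heis \<Rightarrow> 'n heis"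
  assumes V0: "snd (frame_coords p u) = 0"
  shows "(\<Sum>b\<in>Basis. frame_coords p (V' (of_frame p b) + heis_chr p (of_frame p b) u) \<bullet> b)
   = (\<Sum>i\<in>UNIV. fst (V' (axis i 1, Jrot (axis i 1) \<bullet> fst p)) $ i)
     + (snd (V' (0, 1)) - Jrot (fst (V' (0, 1))) \<bullet> fst p)"
proof -
  have B: "(Basis :: 'n heis set) = (\<lambda>i. (axis i 1, 0)) ` UNIV \<union> {(0, 1)}"
    by (auto simp: Basis_prod_def Basis_vec_def)
  have inj: "inj (\<lambda>i. (axis i 1 :: real ^ ('n + 'n), 0::real))"
    by (auto simp: inj_def axis_eq_axis)
  have ni: "(0, 1) \<notin> range (\<lambda>i. (axis i 1 :: real ^ ('n + 'n), 0::real))" by auto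
  show ?thesis
    unfolding B using ni
    by (simp add: sum.reindex[OF inj] linear_add[OF linear_frame_coords] frame_coords_heis_chr V0
        inner_prod_def fst_frame_coords of_frame_def Jrot_linear inner_axis inner_Jrot_self
        inner_add_left sum.distrib)
      (simp add: frame_coords_Jrot inner_axis[symmetric] inner_Jrot_self)
qed

section \<open>Hypersurfaces of revolution\<close>

text \<open>
  The rotations of a Euclidean space of dimension at least two act transitively on spheres.
\<close>

lemma rotation_invariant_mem:
  fixes S :: "'n::finite heis set"
  assumes S: "rotation_invariant S" and mem: "(z, \<tau>) \<in> S" and z: "norm z' = norm z"
  shows "(z', \<tau>) \<in> S"
proof -
  have "2 \<le> CARD('n + 'n)" using one_le_card_finite[where 'a='n] by (simp only: card_sum)
  then obtain R where R: "orthogonal_transformation R" "det (matrix R) = 1" "R z = z'"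
    using rotation_exists[of z z'] z by metis
  then have "(\<lambda>(z, \<tau>). (R z, \<tau>)) ` S = S" using S by (simp add: rotation_invariant_def)
  with mem R(3) show ?thesis by force
qed

lemma generating_curveD:
  assumes "generating_curve k S I x t dx dt" "s \<in> I"
  shows "(x has_real_derivative dx s) (at s within I)" "(t has_real_derivative dt s) (at s within I)"
    "(dx s)\<^sup>2 + (dt s)\<^sup>2 = 1"
  using assms by (simp_all only: generating_curve_def)

lemma generating_curve_nonneg:
  assumes "generating_curve k S I x t dx dt" "s \<in> I"
  shows "x s \<ge> 0"
proof -
  have "(x s *\<^sub>R axis (Inl k) 1, t s) \<in> half_plane k"
    using assms unfolding generating_curve_def by blast
  then obtain r where r: "r \<ge> 0" "x s *\<^sub>R axis (Inl k) 1 = r *\<^sub>R (axis (Inl k) 1 :: real ^ ('a + 'a))"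
    by (auto simp: half_plane_def)
  then show ?thesis by (simp add: axis_eq_0_iff)
qed

text \<open>
  A hypersurface of revolution is determined by its generating curve. This makes it easy to exhibit
  curves in \<open>S\<close>: only the distance from the axis and the height matter.
\<close>

lemma generating_curve_mem_iff:
  fixes S :: "'n::finite heis set"
  assumes S: "rotation_invariant S" and gen: "generating_curve k S I x t dx dt"
  shows "(z, \<tau>) \<in> S \<longleftrightarrow> (\<exists>s\<in>I. x s = norm z \<and> t s = \<tau>)"
proof -
  have im: "(\<lambda>s. (x s *\<^sub>R axis (Inl k) 1, t s)) ` I = S \<inter> half_plane k"
    using gen by (simp add: generating_curve_def)
  show ?thesis
  proof
    assume "(z, \<tau>) \<in> S"
    then have "(norm z *\<^sub>R axis (Inl k) 1, \<tau>) \<in> S \<inter> half_plane k"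
      using rotation_invariant_mem[OF S, of z \<tau> "norm z *\<^sub>R axis (Inl k) 1"]
      by (auto simp: half_plane_def)
    then have "(norm z *\<^sub>R axis (Inl k) 1, \<tau>)
        \<in> (\<lambda>s. (x s *\<^sub>R (axis (Inl k) 1 :: real ^ ('n + 'n)), t s)) ` I"
      by (simp only: im)
    then obtain s where s: "s \<in> I"
      "(norm z *\<^sub>R axis (Inl k) 1, \<tau>) = (x s *\<^sub>R (axis (Inl k) 1 :: real ^ ('n + 'n)), t s)"
      by (rule imageE)
    then have "t s = \<tau>" "x s = norm z" by (simp_all add: axis_eq_0_iff)
    with s(1) show "\<exists>s\<in>I. x s = norm z \<and> t s = \<tau>" by blast
  next
    assume "\<exists>s\<in>I. x s = norm z \<and> t s = \<tau>"
    then obtain s where s: "s \<in> I" "x s = norm z" "t s = \<tau>" by blast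
    have "(x s *\<^sub>R axis (Inl k) 1, t s) \<in> S \<inter> half_plane k"
      unfolding im[symmetric] by (rule imageI[OF s(1)])
    then have "(x s *\<^sub>R axis (Inl k) 1, \<tau>) \<in> S" using s(3) by simp
    then show "(z, \<tau>) \<in> S"
      by (rule rotation_invariant_mem[OF S]) (simp add: s(2))
  qed
qed

lemma profile_normal_eq:
  fixes N :: "'n::finite heis \<Rightarrow> 'n heis"
  assumes prof: "has_profile_normal N I x t dx dt" and s: "s \<in> I" "x s > 0"
    and unit: "(dx s)\<^sup>2 + (dt s)\<^sup>2 = 1" and z: "norm z = x s"
  shows "N (z, t s) = of_frame (z, t s) ((1 / sqrt (1 + (x s)\<^sup>2 * (dx s)\<^sup>2)) *\<^sub>R
    (- dx s *\<^sub>R Jrot z - (dt s / x s) *\<^sub>R z, dx s))"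
proof -
  define \<omega> where "\<omega> = (1 / x s) *\<^sub>R z"
  have \<omega>: "norm \<omega> = 1" "x s *\<^sub>R \<omega> = z" using s z by (simp_all add: \<omega>_def)
  define h where "h = - dx s *\<^sub>R Jrot z - (dt s / x s) *\<^sub>R z"
  have h: "x s * dx s * \<omega> $ Inr k - dt s * \<omega> $ Inl k = h $ Inl k"
    "- (x s * dx s * \<omega> $ Inl k) - dt s * \<omega> $ Inr k = h $ Inr k" for k
    using s by (simp_all add: h_def \<omega>_def Jrot_def)
  show ?thesis
    using prof[unfolded has_profile_normal_def, rule_format, OF s \<omega>(1)]
    unfolding Let_def \<omega>(2) h frame_sum unit
    by (simp only: h_def linear_cmul[OF linear_of_frame, symmetric] scaleR_Pair real_scaleR_def)
qed

text \<open>
  For orthogonal \<open>e\<close> and \<open>w\<close> with \<open>e\<close> of unit length, a curve in the unit sphere with velocity \<open>w\<close> at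
  \<open>e\<close>.
\<close>

definition sphere_curve :: "'a::real_inner \<Rightarrow> 'a \<Rightarrow> real \<Rightarrow> 'a" where
  "sphere_curve e w r = (1 / sqrt (1 + r\<^sup>2 * (w \<bullet> w))) *\<^sub>R (e + r *\<^sub>R w)"

lemma sphere_curve_0 [simp]: "sphere_curve e w 0 = e"
  by (simp add: sphere_curve_def)

lemma norm_sphere_curve:
  assumes "norm e = 1" "e \<bullet> w = 0"
  shows "norm (sphere_curve e w r) = 1"
proof -
  have "1 + r\<^sup>2 * (w \<bullet> w) > 0" by (intro add_pos_nonneg) simp_all
  moreover have "norm (e + r *\<^sub>R w) = sqrt (1 + r\<^sup>2 * (w \<bullet> w))"
    using assms unfolding norm_eq_sqrt_inner
    by (simp add: inner_simps inner_commute[of w e] power2_eq_square)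
  ultimately show ?thesis by (simp add: sphere_curve_def)
qed

lemma has_vector_derivative_sphere_curve:
  "(sphere_curve e w has_vector_derivative w) (at 0)"
proof -
  have "((\<lambda>r. 1 / sqrt (1 + r\<^sup>2 * (w \<bullet> w))) has_real_derivative 0) (at 0)"
    by (auto intro!: derivative_eq_intros)
  moreover have "((\<lambda>r. e + r *\<^sub>R w) has_vector_derivative w) (at 0)"
    by (auto intro!: derivative_eq_intros)
  ultimately have "((\<lambda>r. (1 / sqrt (1 + r\<^sup>2 * (w \<bullet> w))) *\<^sub>R (e + r *\<^sub>R w)) has_vector_derivative
      ((1 / sqrt (1 + 0\<^sup>2 * (w \<bullet> w))) *\<^sub>R w + 0 *\<^sub>R (e + 0 *\<^sub>R w))) (at 0)"
    by (rule has_vector_derivative_scaleR)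
  then show ?thesis by (simp add: sphere_curve_def[abs_def])
qed

text \<open>
  One inclusion is the orthogonality of \<open>N\<close> to the tangent vectors. For the other one, a vector
  orthogonal to \<open>N\<close> is the sum of a multiple \<open>\<mu>\<close> of the velocity of the generating curve and a
  rotational vector, and the velocity of a curve that moves along the generating curve and a sphere
  simultaneously.
\<close>

lemma tangent_space_at_profile:
  fixes S :: "'n::finite heis set"
  assumes S: "rotation_invariant S" and gen: "generating_curve k S I x t dx dt"
    and N: "unit_normal S N" and prof: "has_profile_normal N I x t dx dt"
    and s0: "s0 \<in> interior I" "x s0 > 0"
    and p: "p = (x s0 *\<^sub>R axis (Inl k) 1, t s0)"
  shows "tangent_space S p = {v. metric p (N p) v = 0}"
proof -
  have sI: "s0 \<in> I" using s0 interior_subset by auto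
  have pS: "p \<in> S" using sI s0(2) unfolding p generating_curve_mem_iff[OF S gen] by (intro bexI[of _ s0]) simp_all
  have unit: "(dx s0)\<^sup>2 + (dt s0)\<^sup>2 = 1"
    and dx: "(x has_real_derivative dx s0) (at s0)" and dt: "(t has_real_derivative dt s0) (at s0)"
    using generating_curveD[OF gen sI] by (simp_all only: at_within_interior[OF s0(1)])
  define e :: "real ^ ('n + 'n)" where "e = axis (Inl k) 1"
  have e: "e \<bullet> e = 1" "norm e = 1" by (simp_all add: e_def inner_axis_axis)
  have pe: "p = (x s0 *\<^sub>R e, t s0)" by (simp add: p e_def)
  have "v \<in> tangent_space S p" if v: "metric p (N p) v = 0" for v
  proof -
    define \<alpha> where "\<alpha> = e \<bullet> fst v"
    define c where "c = 1 / sqrt (1 + (x s0)\<^sup>2 * (dx s0)\<^sup>2)"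
    have "1 + (x s0)\<^sup>2 * (dx s0)\<^sup>2 > 0" by (intro add_pos_nonneg) simp_all
    then have c: "c \<noteq> 0" by (simp add: c_def)
    have "N p = of_frame p (c *\<^sub>R (- dx s0 *\<^sub>R Jrot (x s0 *\<^sub>R e) - (dt s0 / x s0) *\<^sub>R (x s0 *\<^sub>R e), dx s0))"
      using profile_normal_eq[OF prof sI s0(2) unit, of "x s0 *\<^sub>R e"] s0(2) e by (simp add: pe c_def)
    then have "c * (- dx s0 * (Jrot (x s0 *\<^sub>R e) \<bullet> fst v) - dt s0 * \<alpha>
        + dx s0 * (snd v - Jrot (fst v) \<bullet> (x s0 *\<^sub>R e))) = 0"
      using v s0(2) by (simp add: metric_def frame_coords_Jrot[of _ v] inner_prod_def pe inner_simps \<alpha>_def algebra_simps)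
    then have "c * (dx s0 * snd v - dt s0 * \<alpha>) = 0"
      unfolding Jrot_antisym[of "fst v" "x s0 *\<^sub>R e"] by (simp add: algebra_simps)
    then have tang: "dx s0 * snd v = dt s0 * \<alpha>" using c by simp
    \<comment> \<open>Orthogonality to \<open>N\<close> has become: \<open>(\<alpha>, snd v)\<close> is parallel to the unit vector \<open>(dx s0, dt s0)\<close>.\<close>
    define \<mu> where "\<mu> = dx s0 * \<alpha> + dt s0 * snd v"
    have "\<mu> * dx s0 = \<alpha> * (dx s0)\<^sup>2 + dt s0 * (dx s0 * snd v)"
      by (simp add: \<mu>_def algebra_simps power2_eq_square)
    then have 1: "\<mu> * dx s0 = \<alpha> * ((dx s0)\<^sup>2 + (dt s0)\<^sup>2)"
      unfolding tang by (simp add: algebra_simps power2_eq_square)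
    have "\<mu> * dt s0 = dx s0 * (dt s0 * \<alpha>) + snd v * (dt s0)\<^sup>2"
      by (simp add: \<mu>_def algebra_simps power2_eq_square)
    then have 2: "\<mu> * dt s0 = snd v * ((dx s0)\<^sup>2 + (dt s0)\<^sup>2)"
      unfolding tang[symmetric] by (simp add: algebra_simps power2_eq_square)
    from 1 2 have \<mu>: "\<mu> * dx s0 = \<alpha>" "\<mu> * dt s0 = snd v" by (simp_all add: unit)
    define w where "w = (1 / x s0) *\<^sub>R (fst v - \<alpha> *\<^sub>R e)"
    have ew: "e \<bullet> w = 0" by (simp add: w_def \<alpha>_def inner_diff_right e)
    define cv where "cv r = (x (s0 + \<mu> * r) *\<^sub>R sphere_curve e w r, t (s0 + \<mu> * r))" for r
    obtain d where d: "d > 0" "ball s0 d \<subseteq> I"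
      using s0(1) unfolding mem_interior by blast
    define \<epsilon> where "\<epsilon> = d / (\<bar>\<mu>\<bar> + 1)"
    have \<epsilon>: "\<epsilon> > 0" using d(1) by (simp add: \<epsilon>_def)
    have in_I: "s0 + \<mu> * r \<in> I" if "\<bar>r\<bar> < \<epsilon>" for r
    proof (rule subsetD[OF d(2)])
      have "\<bar>\<mu> * r\<bar> \<le> (\<bar>\<mu>\<bar> + 1) * \<bar>r\<bar>" by (simp add: abs_mult mult_right_mono)
      also have "\<dots> < d" using that by (simp add: \<epsilon>_def field_simps)
      finally show "s0 + \<mu> * r \<in> ball s0 d" by (simp add: dist_real_def)
    qed
    have "cv 0 = p" by (simp add: cv_def pe)
    moreover have "cv r \<in> S" if "\<bar>r\<bar> < \<epsilon>" for r
      unfolding cv_def generating_curve_mem_iff[OF S gen]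
      using in_I[OF that] generating_curve_nonneg[OF gen in_I[OF that]]
      by (intro bexI[of _ "s0 + \<mu> * r"]) (simp_all add: norm_sphere_curve[OF e(2) ew])
    moreover have "(cv has_vector_derivative v) (at 0)"
    proof -
      have lin: "((\<lambda>r. s0 + \<mu> * r) has_real_derivative \<mu>) (at 0)"
        by (auto intro!: derivative_eq_intros)
      have "((\<lambda>r. x (s0 + \<mu> * r)) has_real_derivative dx s0 * \<mu>) (at 0)"
        by (rule DERIV_chain2[of x]) (use lin dx in simp_all)
      then have f: "((\<lambda>r. x (s0 + \<mu> * r)) has_real_derivative \<alpha>) (at 0)"
        using \<mu> by (simp add: mult.commute)
      have "((\<lambda>r. t (s0 + \<mu> * r)) has_real_derivative dt s0 * \<mu>) (at 0)"
        by (rule DERIV_chain2[of t]) (use lin dt in simp_all)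
      then have g: "((\<lambda>r. t (s0 + \<mu> * r)) has_vector_derivative snd v) (at 0)"
        using \<mu> by (simp add: mult.commute has_real_derivative_iff_has_vector_derivative)
      have "(cv has_vector_derivative
          (x (s0 + \<mu> * 0) *\<^sub>R w + \<alpha> *\<^sub>R sphere_curve e w 0, snd v)) (at 0)"
        unfolding cv_def
        by (rule has_vector_derivative_Pair[OF has_vector_derivative_scaleR[OF f
              has_vector_derivative_sphere_curve] g])
      moreover have "x (s0 + \<mu> * 0) *\<^sub>R w + \<alpha> *\<^sub>R sphere_curve e w 0 = fst v"
        using s0(2) by (simp add: w_def)
      ultimately show ?thesis by simp
    qed
    ultimately show ?thesis
      unfolding tangent_space_def by (intro CollectI exI[of _ cv] exI[of _ \<epsilon>] conjI \<epsilon>) simp_all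
  qed
  moreover have "metric p (N p) v = 0" if "v \<in> tangent_space S p" for v
    using N pS that by (simp add: unit_normal_def)
  ultimately show ?thesis by blast
qed

section \<open>The angle as a function on the half-plane\<close>

text \<open>
  Stated within \<open>I\<close>, in order to cover the endpoints of the generating curve.
\<close>

lemma level_set_orthogonal:
  fixes c :: "real \<Rightarrow> 'a::real_inner"
  assumes F: "(F has_derivative (\<lambda>h. G \<bullet> h)) (at (c s))" "F (c s) = (0::real)"
    and c: "(c has_vector_derivative v) (at s within I)" and s: "s \<in> I" "s islimpt I"
    and zero: "\<forall>\<^sub>F r in at s within I. F (c r) = 0"
  shows "G \<bullet> v = 0"
proof -
  have "(F \<circ> c has_derivative (\<lambda>h. G \<bullet> h) \<circ> (\<lambda>h. h *\<^sub>R v)) (at s within I)"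
    using c unfolding has_vector_derivative_def
    by (rule diff_chain_within) (rule has_derivative_at_withinI[OF F(1)])
  then have "(F \<circ> c has_vector_derivative (G \<bullet> v)) (at s within I)"
    by (simp add: has_vector_derivative_def comp_def)
  moreover have "(F \<circ> c has_vector_derivative 0) (at s within I)"
    unfolding has_vector_derivative_def
  proof (rule has_derivative_transform_eventually)
    show "((\<lambda>_. 0) has_derivative (\<lambda>h. h *\<^sub>R 0)) (at s within I)" by simp
    show "\<forall>\<^sub>F r in at s within I. 0 = (F \<circ> c) r" using zero by eventually_elim simp
  qed (simp_all add: F(2) s(1))
  moreover have "at s within I \<noteq> bot" using s(2) by (simp add: trivial_limit_within)
  ultimately show ?thesis by (metis vector_derivative_unique_within)
qed

lemma sin_cos_arctan_tan:
  assumes "cos u > 0"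
  shows "cos (arctan (tan u)) = cos u" "sin (arctan (tan u)) = sin u"
proof -
  have "1 + (tan u)\<^sup>2 = (1 / cos u)\<^sup>2"
    using assms by (simp add: tan_def field_simps)
  then have "sqrt (1 + (tan u)\<^sup>2) = 1 / cos u" using assms by (simp add: real_sqrt_abs del: power_divide)
  then show "cos (arctan (tan u)) = cos u" "sin (arctan (tan u)) = sin u"
    using assms by (simp_all add: cos_arctan sin_arctan tan_def)
qed

text \<open>
  Let \<open>(g1, g2)\<close> be the gradient of a defining function restricted to the half-plane. It does not
  vanish at the given point, as the full gradient does not and is orthogonal to the orbits of
  rotations. It is orthogonal to the curve, which determines the tangent of \<open>\<sigma> s - \<sigma> s0\<close> as a quotient
  of linear combinations of \<open>g1\<close> and \<open>g2\<close>. This leaves an ambiguity by \<open>\<pi>\<close>, resolved by the normal: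
  the sign of \<open>cos (\<sigma> s - \<sigma> s0)\<close> can be read off \<open>N\<close>, which is continuous on the hypersurface.

  The identities for sine and cosine are claimed for all parameters whose point is near the given one,
  because the curve may return to a point of the half-plane, with an angle that differs by a
  multiple of \<open>2 \<pi>\<close>.
\<close>

lemma angle_field_exists:
  fixes S :: "'n::finite heis set"
  assumes C2: "C2_hypersurface S" and S: "rotation_invariant S"
    and gen: "generating_curve k S I x t dx dt" and ang: "angle_function I dx dt \<sigma>"
    and N: "unit_normal S N" and prof: "has_profile_normal N I x t dx dt"
    and lim: "\<And>s. s \<in> I \<Longrightarrow> s islimpt I" and s0: "s0 \<in> I" "x s0 > 0"
  obtains \<theta> W where "open W" "(x s0, t s0) \<in> W" "\<theta> differentiable (at (x s0, t s0))"
    "\<theta> (x s0, t s0) = \<sigma> s0"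
    "\<And>s. s \<in> I \<Longrightarrow> (x s, t s) \<in> W \<Longrightarrow>
        sin (\<sigma> s) = sin (\<theta> (x s, t s)) \<and> cos (\<sigma> s) = cos (\<theta> (x s, t s))"
    "\<forall>\<^sub>F s in at s0 within I. \<sigma> s = \<theta> (x s, t s)"
proof -
  define e :: "real ^ ('n + 'n)" where "e = axis (Inl k) 1"
  have e: "norm e = 1" "e \<bullet> e = 1" by (simp_all add: e_def inner_axis_axis)
  define \<iota> :: "real \<times> real \<Rightarrow> 'n heis" where "\<iota> y = (fst y *\<^sub>R e, snd y)" for y
  define y0 where "y0 = (x s0, t s0)"
  define a where "a = \<sigma> s0"
  have \<iota>: "(\<iota> has_derivative \<iota>) (at y within Y)" for y Y
    unfolding \<iota>_def by (auto intro!: derivative_eq_intros)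
  have dx: "dx s = sin (\<sigma> s)" "dt s = cos (\<sigma> s)" if "s \<in> I" for s
    using ang that by (simp_all add: angle_function_def)
  have curve: "\<iota> (x s, t s) \<in> S" if "s \<in> I" for s
    using generating_curve_nonneg[OF gen that] that
    unfolding \<iota>_def generating_curve_mem_iff[OF S gen] by (intro bexI[of _ s]) (simp_all add: e)
  have curve': "((\<lambda>s. (x s, t s)) has_vector_derivative (sin (\<sigma> s), cos (\<sigma> s))) (at s within I)"
    if "s \<in> I" for s
    using generating_curveD(1,2)[OF gen that] dx[OF that]
    by (intro has_vector_derivative_Pair) (simp_all add: has_real_derivative_iff_has_vector_derivative)
  obtain W0 F G and K :: "'n heis \<Rightarrow> 'n heis \<Rightarrow>\<^sub>L 'n heis" where W0: "open W0" "\<iota> y0 \<in> W0"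
      and SW: "S \<inter> W0 = {q \<in> W0. F q = (0::real)}"
      and FG: "\<forall>q\<in>W0. (F has_derivative (\<lambda>h. G q \<bullet> h)) (at q)
             \<and> (G has_derivative blinfun_apply (K q)) (at q) \<and> G q \<noteq> 0"
    using C2[unfolded C2_hypersurface_def, rule_format, OF curve[OF s0(1)]] unfolding y0_def by blast
  have F0: "F q = 0" if "q \<in> S" "q \<in> W0" for q using SW that by blast
  define g1 where "g1 y = G (\<iota> y) \<bullet> (e, 0)" for y
  define g2 where "g2 y = G (\<iota> y) \<bullet> (0, 1)" for y
  have orth: "g1 (x s, t s) * sin (\<sigma> s) + g2 (x s, t s) * cos (\<sigma> s) = 0"
    if s: "s \<in> I" "\<iota> (x s, t s) \<in> W0" for s
  proof -
    have c: "((\<lambda>s. \<iota> (x s, t s)) has_vector_derivative \<iota> (sin (\<sigma> s), cos (\<sigma> s))) (at s within I)"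
      using diff_chain_within[OF curve'[OF s(1), unfolded has_vector_derivative_def] \<iota>]
      by (simp add: has_vector_derivative_def comp_def \<iota>_def)
    have "\<forall>\<^sub>F r in at s within I. \<iota> (x r, t r) \<in> W0"
      using has_vector_derivative_continuous[OF c] W0(1) s(2)
      unfolding continuous_within by (rule topological_tendstoD)
    moreover have "\<forall>\<^sub>F r in at s within I. r \<in> I" by (simp add: eventually_at_filter)
    ultimately have "\<forall>\<^sub>F r in at s within I. F (\<iota> (x r, t r)) = 0"
      by eventually_elim (simp add: F0 curve)
    then have "G (\<iota> (x s, t s)) \<bullet> \<iota> (sin (\<sigma> s), cos (\<sigma> s)) = 0"
      by (intro level_set_orthogonal[where c = "\<lambda>s. \<iota> (x s, t s)" and F = F, OF _ _ c s(1) lim[OF s(1)]])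
        (use FG s F0[OF curve[OF s(1)] s(2)] in simp_all)
    then show ?thesis by (simp add: g1_def g2_def \<iota>_def inner_prod_def mult.commute)
  qed
  have rot: "G (\<iota> y0) \<bullet> (w, 0) = 0" if w: "e \<bullet> w = 0" for w
  proof -
    define c where "c r = (x s0 *\<^sub>R sphere_curve e w r, t s0)" for r
    have cD: "(c has_vector_derivative (x s0 *\<^sub>R w, 0)) (at 0)"
      unfolding c_def
      by (intro has_vector_derivative_Pair has_vector_derivative_const
          bounded_linear.has_vector_derivative[OF bounded_linear_scaleR_right] has_vector_derivative_sphere_curve)
    have cS: "c r \<in> S" for r
      unfolding c_def generating_curve_mem_iff[OF S gen]
      using s0 by (intro bexI[of _ s0]) (simp_all add: norm_sphere_curve[OF e(1) w])
    have c0: "c 0 = \<iota> y0" by (simp add: c_def \<iota>_def y0_def)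
    have "(c \<longlongrightarrow> \<iota> y0) (at 0)"
      using has_vector_derivative_continuous[OF cD] by (simp add: continuous_within c0)
    from topological_tendstoD[OF this W0] have "\<forall>\<^sub>F r in at 0. F (c r) = 0"
      by eventually_elim (rule F0[OF cS])
    then have "G (\<iota> y0) \<bullet> (x s0 *\<^sub>R w, 0) = 0"
      using FG W0(2) F0[OF cS, of 0] cD
      by (intro level_set_orthogonal[where c = c and F = F and s = 0 and I = UNIV]) (simp_all add: c0)
    then show ?thesis using s0(2) by (simp add: inner_prod_def)
  qed
  have nz: "g1 y0 \<noteq> 0 \<or> g2 y0 \<noteq> 0"
  proof (rule ccontr)
    assume "\<not> ?thesis"
    then have g: "fst (G (\<iota> y0)) \<bullet> e = 0" "snd (G (\<iota> y0)) = 0"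
      by (simp_all add: g1_def g2_def inner_prod_def)
    with rot[of "fst (G (\<iota> y0))"] have "fst (G (\<iota> y0)) = 0"
      by (simp add: inner_prod_def inner_commute[of e])
    with g have "G (\<iota> y0) = 0" by (simp add: prod_eq_iff)
    then show False using FG W0(2) by blast
  qed
  \<comment> \<open>The components of the gradient along the curve at \<open>s0\<close> and along its normal there.\<close>
  define m where "m y = g2 y * cos a + g1 y * sin a" for y
  define d where "d y = g2 y * sin a - g1 y * cos a" for y
  have g12: "g1 y = m y * sin a - d y * cos a" "g2 y = m y * cos a + d y * sin a" for y
  proof -
    have "m y * sin a - d y * cos a = g1 y * (sin a * sin a + cos a * cos a)"
      "m y * cos a + d y * sin a = g2 y * (sin a * sin a + cos a * cos a)"
      unfolding m_def d_def by (simp_all only: algebra_simps)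
    then show "g1 y = m y * sin a - d y * cos a" "g2 y = m y * cos a + d y * sin a"
      by (simp_all add: power2_eq_square[symmetric])
  qed
  have m0: "m y0 = 0"
    using orth[OF s0(1)] W0(2) by (simp add: m_def a_def y0_def add.commute)
  have d0: "d y0 \<noteq> 0" using nz g12[of y0] m0 by auto
  have GD: "((\<lambda>y. G (\<iota> y)) has_derivative (\<lambda>h. K (\<iota> y0) (\<iota> h))) (at y0)"
    using has_derivative_compose[OF \<iota>, of G "K (\<iota> y0)" y0 UNIV] FG W0(2) by simp
  have gD: "(g1 has_derivative (\<lambda>h. K (\<iota> y0) (\<iota> h) \<bullet> (e, 0))) (at y0)"
    "(g2 has_derivative (\<lambda>h. K (\<iota> y0) (\<iota> h) \<bullet> (0, 1))) (at y0)"
    unfolding g1_def g2_def by (auto intro!: derivative_eq_intros GD)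
  then have gd: "g1 differentiable (at y0)" "g2 differentiable (at y0)"
    unfolding differentiable_def by blast+
  have md: "m differentiable (at y0)" "d differentiable (at y0)"
    unfolding m_def d_def using gd by (intro derivative_intros; simp)+
  define \<theta> where "\<theta> y = a + arctan (m y / d y)" for y
  have \<theta>d: "\<theta> differentiable (at y0)"
  proof -
    have "(\<lambda>y. m y / d y) differentiable (at y0)"
      using md d0 by (intro differentiable_divide)
    then obtain q where "((\<lambda>y. m y / d y) has_derivative q) (at y0)"
      unfolding differentiable_def by blast
    from has_derivative_add[OF has_derivative_const DERIV_compose_FDERIV[OF DERIV_arctan this]]
    show ?thesis unfolding \<theta>_def differentiable_def by blast
  qed
  have \<theta>0: "\<theta> y0 = a" by (simp add: \<theta>_def m0)
  \<comment> \<open>The sign of \<open>\<Psi>\<close> at a point of the curve is that of \<open>cos (\<sigma> s - a)\<close>.\<close>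
  define \<Psi> where "\<Psi> q = sin a * snd (frame_coords q (N q)) - cos a * (fst (N q) \<bullet> e)" for q
  have \<Psi>: "\<Psi> (\<iota> (x s, t s)) = cos (\<sigma> s - a) / sqrt (1 + (x s)\<^sup>2 * (sin (\<sigma> s))\<^sup>2)"
    if s: "s \<in> I" "x s > 0" for s
  proof -
    have "N (\<iota> (x s, t s)) = of_frame (\<iota> (x s, t s)) ((1 / sqrt (1 + (x s)\<^sup>2 * (dx s)\<^sup>2)) *\<^sub>R
        (- dx s *\<^sub>R Jrot (x s *\<^sub>R e) - (dt s / x s) *\<^sub>R (x s *\<^sub>R e), dx s))"
      using profile_normal_eq[OF prof s generating_curveD(3)[OF gen s(1)], of "x s *\<^sub>R e"] s(2)
      by (simp add: \<iota>_def e)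
    then show ?thesis
      using s by (simp add: \<Psi>_def dx[OF s(1)] inner_diff_left e Jrot_linear inner_Jrot_self cos_diff
          add_divide_distrib mult.commute)
  qed
  have "continuous_on S \<Psi>"
    unfolding \<Psi>_def frame_coords_Jrot snd_conv using N
    by (intro continuous_intros linear_continuous_on_compose[OF _ linear_Jrot]) (simp_all add: unit_normal_def)
  moreover have pos: "1 + (x s)\<^sup>2 * (sin (\<sigma> s))\<^sup>2 > 0" for s by (intro add_pos_nonneg) simp_all
  then have "\<Psi> (\<iota> y0) \<in> {0<..}" using \<Psi>[OF s0] by (simp add: y0_def a_def)
  ultimately obtain A where A: "open A" "\<iota> y0 \<in> A" "\<And>q. q \<in> S \<Longrightarrow> q \<in> A \<Longrightarrow> \<Psi> q > 0"
    using curve[OF s0(1)] open_greaterThan[of 0]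
    unfolding continuous_on_topological y0_def by (metis greaterThan_iff)
  define P where "P y \<longleftrightarrow> fst y > 0 \<and> d y \<noteq> 0 \<and> \<iota> y \<in> W0 \<and> \<iota> y \<in> A" for y
  have P_ev: "\<forall>\<^sub>F y in nhds y0. P y"
  proof -
    have "isCont d y0" using md(2) by (rule differentiable_imp_continuous_within)
    then have "\<forall>\<^sub>F y in nhds y0. d y \<noteq> 0"
      unfolding continuous_within tendsto_at_iff_tendsto_nhds
      by (intro tendsto_imp_eventually_ne) (use d0 in auto)
    moreover have i: "(\<iota> \<longlongrightarrow> \<iota> y0) (nhds y0)"
      using has_derivative_continuous[OF \<iota>[of y0 UNIV]]
      unfolding continuous_within tendsto_at_iff_tendsto_nhds .
    have "\<forall>\<^sub>F y in nhds y0. \<iota> y \<in> W0" using topological_tendstoD[OF i W0] .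
    moreover have "\<forall>\<^sub>F y in nhds y0. \<iota> y \<in> A" using topological_tendstoD[OF i A(1,2)] .
    moreover have "\<forall>\<^sub>F y in nhds y0. fst y > 0"
      by (rule order_tendstoD(1)[OF tendsto_fst[OF filterlim_ident]]) (simp add: y0_def s0)
    ultimately show ?thesis unfolding P_def by eventually_elim simp
  qed
  have key: "cos (\<sigma> s - a) > 0 \<and> tan (\<sigma> s - a) = m (x s, t s) / d (x s, t s)"
    if s: "s \<in> I" "P (x s, t s)" for s
  proof -
    have "\<Psi> (\<iota> (x s, t s)) > 0" using A(3)[OF curve[OF s(1)]] s(2) by (simp add: P_def)
    then have c: "cos (\<sigma> s - a) > 0"
      using \<Psi>[OF s(1)] s(2) pos[of s] by (simp add: P_def zero_less_divide_iff)
    have "m (x s, t s) * cos (\<sigma> s - a) - d (x s, t s) * sin (\<sigma> s - a)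
      = g1 (x s, t s) * sin (\<sigma> s) + g2 (x s, t s) * cos (\<sigma> s)"
      unfolding g12 cos_diff sin_diff by (simp add: algebra_simps)
    also have "\<dots> = 0" using orth[OF s(1)] s(2) by (simp add: P_def)
    finally show ?thesis using c s(2) by (simp add: P_def tan_def field_simps)
  qed
  obtain W where W: "open W" "y0 \<in> W" "\<And>y. y \<in> W \<Longrightarrow> P y"
    using P_ev unfolding eventually_nhds by blast
  show ?thesis
  proof (rule that[of W \<theta>])
    show "open W" "(x s0, t s0) \<in> W" "\<theta> differentiable at (x s0, t s0)" "\<theta> (x s0, t s0) = \<sigma> s0"
      using W \<theta>d \<theta>0 by (simp_all add: y0_def a_def)
    show "sin (\<sigma> s) = sin (\<theta> (x s, t s)) \<and> cos (\<sigma> s) = cos (\<theta> (x s, t s))"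
      if "s \<in> I" "(x s, t s) \<in> W" for s
    proof -
      define u where "u = \<sigma> s - a"
      from key[OF that(1) W(3)[OF that(2)]]
      have "cos u > 0" "\<theta> (x s, t s) = a + arctan (tan u)" by (simp_all add: \<theta>_def u_def)
      moreover have "\<sigma> s = a + u" by (simp add: u_def)
      ultimately show ?thesis by (simp add: sin_add cos_add sin_cos_arctan_tan)
    qed
    have "((\<lambda>s. (x s, t s)) \<longlongrightarrow> y0) (at s0 within I)"
      using has_vector_derivative_continuous[OF curve'[OF s0(1)]] by (simp add: continuous_within y0_def)
    from topological_tendstoD[OF this W(1,2)] have "\<forall>\<^sub>F s in at s0 within I. (x s, t s) \<in> W" .
    moreover have "(\<sigma> \<longlongrightarrow> a) (at s0 within I)"
      using ang s0(1) by (simp add: angle_function_def continuous_on a_def)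
    then have "\<forall>\<^sub>F s in at s0 within I. dist (\<sigma> s) a < pi / 2" by (rule tendstoD) simp
    moreover have "\<forall>\<^sub>F s in at s0 within I. s \<in> I" by (simp add: eventually_at_filter)
    ultimately show "\<forall>\<^sub>F s in at s0 within I. \<sigma> s = \<theta> (x s, t s)"
    proof eventually_elim
      case (elim s)
      then have "tan (\<sigma> s - a) = m (x s, t s) / d (x s, t s)" using key W(3) by blast
      moreover have "arctan (tan (\<sigma> s - a)) = \<sigma> s - a"
        using elim(2) unfolding dist_real_def by (intro arctan_tan) linarith+
      ultimately show ?case by (simp add: \<theta>_def)
    qed
  qed
qed

section \<open>The horizontal normal as an ambient field\<close>

text \<open>
  The formula for the horizontal normal of a hypersurface of revolution, with an arbitrary angle function
  \<open>\<theta>\<close> on the half-plane. The result is a horizontal unit field away from the axis whatever \<open>\<theta>\<close> is.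
\<close>

definition profile_field :: "(real \<times> real \<Rightarrow> real) \<Rightarrow> 'n::finite heis \<Rightarrow> 'n heis" where
  "profile_field \<theta> q =
     (let r = norm (fst q); a = \<theta> (r, snd q)
      in of_frame q (- (1 / horizontal_length r a) *\<^sub>R (sin a *\<^sub>R Jrot (fst q) + (cos a / r) *\<^sub>R fst q), 0))"

lemma norm_profile_vector:
  assumes "norm z = r" "r > 0"
  shows "norm (sin a *\<^sub>R Jrot z + (cos a / r) *\<^sub>R z) = horizontal_length r a"
proof -
  have z: "z \<bullet> z = r\<^sup>2" using assms by (simp add: dot_square_norm)
  have "(sin a *\<^sub>R Jrot z + (cos a / r) *\<^sub>R z) \<bullet> (sin a *\<^sub>R Jrot z + (cos a / r) *\<^sub>R z)
      = r\<^sup>2 * (sin a)\<^sup>2 + (cos a)\<^sup>2"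
    using assms by (simp add: inner_simps inner_Jrot_Jrot inner_Jrot_self inner_commute[of z "Jrot z"] z
        power2_eq_square)
  then show ?thesis by (simp add: norm_eq_sqrt_inner horizontal_length_def)
qed

lemma profile_field_unit:
  assumes "fst q \<noteq> 0"
  shows "metric q (profile_field \<theta> q) (profile_field \<theta> q) = 1"
proof -
  define r where "r = norm (fst q)"
  have r: "norm (fst q) = r" "r > 0" using assms by (simp_all add: r_def)
  define a where "a = \<theta> (r, snd q)"
  define h where "h = sin a *\<^sub>R Jrot (fst q) + (cos a / r) *\<^sub>R fst q"
  have "h \<bullet> h = (horizontal_length r a)\<^sup>2" unfolding h_def norm_profile_vector[OF r, symmetric] by (rule dot_square_norm)
  moreover have "metric q (profile_field \<theta> q) (profile_field \<theta> q) = (1 / horizontal_length r a) * ((1 / horizontal_length r a) * (h \<bullet> h))"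
    unfolding metric_def profile_field_def Let_def frame_coords_of_frame r(1) a_def[symmetric] h_def[symmetric]
    by (simp add: inner_prod_def)
  ultimately show ?thesis
    using horizontal_length_pos[of r a] r(2) by (simp add: power2_eq_square)
qed

lemma profile_field_horizontal: "metric q (profile_field \<theta> q) (0, 1) = 0"
  by (simp add: metric_def profile_field_def Let_def frame_coords_Jrot[of _ "(0, 1)"] Jrot_linear)

lemma horizontal_normal_profile:
  fixes N :: "'n::finite heis \<Rightarrow> 'n heis"
  assumes prof: "has_profile_normal N I x t dx dt" and s: "s \<in> I" "x s > 0"
    and unit: "(dx s)\<^sup>2 + (dt s)\<^sup>2 = 1" and z: "norm z = x s"
    and a: "dx s = sin (\<theta> (x s, t s))" "dt s = cos (\<theta> (x s, t s))"
  shows "horizontal_normal N (z, t s) = profile_field \<theta> (z, t s)"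
proof -
  define a where "a = \<theta> (x s, t s)"
  define c where "c = 1 / sqrt (1 + (x s)\<^sup>2 * (dx s)\<^sup>2)"
  define h where "h = sin a *\<^sub>R Jrot z + (cos a / x s) *\<^sub>R z"
  have "1 + (x s)\<^sup>2 * (dx s)\<^sup>2 > 0" by (intro add_pos_nonneg) simp_all
  then have c: "c > 0" by (simp add: c_def)
  have "- dx s *\<^sub>R Jrot z - (dt s / x s) *\<^sub>R z = - h"
    unfolding a by (simp add: h_def a_def)
  then have N: "fst (N (z, t s)) = - (c *\<^sub>R h)"
    using profile_normal_eq[OF prof s unit z] by (simp add: c_def)
  have "norm h = horizontal_length (x s) a" unfolding h_def by (rule norm_profile_vector[OF z s(2)])
  then have "(1 / norm (fst (N (z, t s)))) *\<^sub>R fst (N (z, t s)) = - (1 / horizontal_length (x s) a) *\<^sub>R h"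
    using c by (simp add: N)
  then show ?thesis
    unfolding horizontal_normal_eq profile_field_def Let_def
    by (simp add: z a_def[symmetric] h_def)
qed

lemma differentiable_profile_coefficients:
  assumes \<theta>: "\<theta> differentiable (at y)" and r: "fst y > (0::real)"
  shows "(\<lambda>y. sin (\<theta> y) / horizontal_length (fst y) (\<theta> y)) differentiable (at y)"
    "(\<lambda>y. cos (\<theta> y) / horizontal_length (fst y) (\<theta> y) / fst y) differentiable (at y)"
proof -
  obtain D where D: "(\<theta> has_derivative D) (at y)" using \<theta> by (auto simp: differentiable_def)
  have s: "horizontal_length (fst y) (\<theta> y) > 0" using r by (simp add: horizontal_length_pos)
  then have p: "0 < (fst y)\<^sup>2 * (sin (\<theta> y))\<^sup>2 + (cos (\<theta> y))\<^sup>2" by (simp add: horizontal_length_def)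
  have "(\<lambda>y. horizontal_length (fst y) (\<theta> y)) differentiable (at y)"
    unfolding horizontal_length_def differentiable_def
    by (rule exI) (rule derivative_eq_intros D refl p)+
  moreover have "(\<lambda>y. sin (\<theta> y)) differentiable (at y)" "(\<lambda>y. cos (\<theta> y)) differentiable (at y)"
    "fst differentiable (at y)"
    unfolding differentiable_def by (rule exI, (rule derivative_eq_intros D refl)+)+
  ultimately show "(\<lambda>y. sin (\<theta> y) / horizontal_length (fst y) (\<theta> y)) differentiable (at y)"
    "(\<lambda>y. cos (\<theta> y) / horizontal_length (fst y) (\<theta> y) / fst y) differentiable (at y)"
    using s r by (auto intro!: differentiable_divide)
qed

lemma partial_derivatives:
  fixes A :: "real \<times> real \<Rightarrow> real"
  assumes "(A has_derivative A') (at (r, \<tau>))"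
  shows "((\<lambda>u. A (u, \<tau>)) has_real_derivative A' (1, 0)) (at r)"
    "((\<lambda>u. A (r, u)) has_real_derivative A' (0, 1)) (at \<tau>)"
    "A' (h, k) = h * A' (1, 0) + k * A' (0, 1)"
proof -
  interpret A': linear A' using assms by (rule has_derivative_linear)
  show lin: "A' (h, k) = h * A' (1, 0) + k * A' (0, 1)" for h k
  proof -
    have "A' (h, k) = A' (h *\<^sub>R (1, 0) + k *\<^sub>R (0, 1))" by simp
    also have "\<dots> = h * A' (1, 0) + k * A' (0, 1)" by (simp only: A'.add A'.scale real_scaleR_def)
    finally show ?thesis .
  qed
  have "((\<lambda>u. (u, \<tau>)) has_derivative (\<lambda>h. (h, 0))) (at r)"
    "((\<lambda>u. (r, u)) has_derivative (\<lambda>h. (0, h))) (at \<tau>)"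
    by (auto intro!: derivative_eq_intros)
  note this[THEN has_derivative_compose, OF assms]
  moreover have e: "(\<lambda>h. A' (h, 0)) = (*) (A' (1, 0))" "(\<lambda>h. A' (0, h)) = (*) (A' (0, 1))"
    by (rule ext, subst lin, simp)+
  ultimately
  show "((\<lambda>u. A (u, \<tau>)) has_real_derivative A' (1, 0)) (at r)"
    "((\<lambda>u. A (r, u)) has_real_derivative A' (0, 1)) (at \<tau>)"
    unfolding has_field_derivative_def e by blast+
qed

text \<open>
  In the coordinates \<open>(z, \<tau>)\<close> the field is \<open>(- A J z - B z, r\<^sup>2 A)\<close>, where
  \<open>A = sin \<theta> / \<rho>\<close> and \<open>B = cos \<theta> / (r \<rho>)\<close>. As \<open>J\<close> is antisymmetric, the trace of its derivative is
  \<open>r\<^sup>2 A\<^sub>\<tau> - r B\<^sub>r - 2 n B\<close>.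
\<close>

lemma profile_field_trace:
  fixes e :: "real ^ ('n::finite + 'n)"
  assumes \<theta>: "(\<theta> has_derivative \<theta>') (at (r, \<tau>))" and r: "r > 0" and e: "norm e = 1"
    and a: "a = \<theta> (r, \<tau>)" and p: "p = (r *\<^sub>R e, \<tau>)"
  obtains V' where "(profile_field \<theta> has_derivative V') (at p)"
    "(\<Sum>b\<in>Basis. frame_coords p (V' (of_frame p b) + heis_chr p (of_frame p b) (profile_field \<theta> p)) \<bullet> b)
     = r\<^sup>2 * \<theta>' (sin a, cos a) / horizontal_length r a ^ 3 + r * (sin a)\<^sup>2 * cos a / horizontal_length r a ^ 3
      - (2 * real CARD('n) - 1) * cos a / (r * horizontal_length r a)"
proof -
  define A where "A = (\<lambda>y. sin (\<theta> y) / horizontal_length (fst y) (\<theta> y))"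
  define B where "B = (\<lambda>y. cos (\<theta> y) / horizontal_length (fst y) (\<theta> y) / fst y)"
  have "\<theta> differentiable (at (r, \<tau>))" using \<theta> by (auto simp: differentiable_def)
  from differentiable_profile_coefficients[OF this] r
  obtain A' B' where A': "(A has_derivative A') (at (r, \<tau>))" and B': "(B has_derivative B') (at (r, \<tau>))"
    unfolding A_def B_def differentiable_def by auto
  note A = partial_derivatives[OF A'] and B = partial_derivatives[OF B'] and T = partial_derivatives[OF \<theta>]
  have v: "horizontal_length r a > 0" using r by (simp add: horizontal_length_pos)
  have At: "A' (0, 1) = cos a * \<theta>' (0, 1) / horizontal_length r a ^ 3"
    using DERIV_unique[OF A(2)] has_derivative_sin_horizontal_length[OF T(2), of r] r
    by (simp add: A_def a)
  define Y where "Y = - (r\<^sup>2 * sin a * \<theta>' (1, 0) + r * 1 * (sin a)\<^sup>2 * cos a) / horizontal_length r a ^ 3"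
  have "((\<lambda>u. cos (\<theta> (u, \<tau>)) / horizontal_length u (\<theta> (u, \<tau>)) / u) has_real_derivative
      (Y * r - cos a / horizontal_length r a * 1) / (r * r)) (at r)"
    unfolding Y_def a
    by (rule DERIV_divide[OF has_derivative_cos_horizontal_length[OF DERIV_ident T(1)] DERIV_ident]) (use r in auto)
  from DERIV_unique[OF B(1)[unfolded B_def fst_conv] this]
  \<comment> \<open>\<open>Y\<close> is the radial derivative of \<open>cos \<theta> / \<rho> = r B\<close>.\<close>
  have Br: "B' (1, 0) * r = Y - cos a / horizontal_length r a / r"
    using r by (simp add: diff_divide_distrib left_diff_distrib)
  define c where "c q = (norm (fst q), snd q)" for q :: "'n heis"
  have V: "profile_field \<theta> q = (- A (c q) *\<^sub>R Jrot (fst q) - B (c q) *\<^sub>R fst q,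
      (fst q \<bullet> fst q) * A (c q))" for q :: "'n heis"
    by (simp add: profile_field_def Let_def of_frame_def A_def B_def c_def Jrot_linear Jrot_Jrot
        inner_simps inner_Jrot_self scaleR_add_right)
  have e1: "e \<bullet> e = 1" using e by (simp add: dot_square_norm)
  have cp: "c p = (r, \<tau>)" using r e by (simp add: c_def p)
  have re: "r *\<^sub>R e \<noteq> 0" using r e by auto
  have "((\<lambda>q::'n heis. norm (fst q)) has_derivative (\<lambda>h. e \<bullet> fst h)) (at p)"
  proof -
    have "(norm has_derivative (\<lambda>h. h \<bullet> sgn (r *\<^sub>R e))) (at (fst p))"
      using has_derivative_norm[OF re] by (simp add: p)
    from has_derivative_compose[OF has_derivative_fst[OF has_derivative_ident] this]
    show ?thesis using r e by (simp add: sgn_div_norm inner_commute)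
  qed
  then have cD: "(c has_derivative (\<lambda>h. (e \<bullet> fst h, snd h))) (at p)"
    unfolding c_def by (intro has_derivative_Pair has_derivative_snd has_derivative_ident)
  have AD: "((\<lambda>q. A (c q)) has_derivative (\<lambda>h. A' (e \<bullet> fst h, snd h))) (at p)"
    by (rule has_derivative_compose[OF cD]) (simp add: cp A')
  have BD: "((\<lambda>q. B (c q)) has_derivative (\<lambda>h. B' (e \<bullet> fst h, snd h))) (at p)"
    by (rule has_derivative_compose[OF cD]) (simp add: cp B')
  have "bounded_linear Jrot" by (simp add: linear_Jrot linear_conv_bounded_linear[symmetric])
  note JD = bounded_linear.has_derivative[OF this has_derivative_fst[OF has_derivative_ident]]
  define V' :: "'n heis \<Rightarrow> 'n heis" where "V' h =
    (- (A (r, \<tau>) *\<^sub>R Jrot (fst h) + A' (e \<bullet> fst h, snd h) *\<^sub>R Jrot (r *\<^sub>R e))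
       - (B (r, \<tau>) *\<^sub>R fst h + B' (e \<bullet> fst h, snd h) *\<^sub>R (r *\<^sub>R e)),
     (r *\<^sub>R e \<bullet> r *\<^sub>R e) * A' (e \<bullet> fst h, snd h) + 2 * r * (e \<bullet> fst h) * A (r, \<tau>))" for h
  have VD: "(profile_field \<theta> has_derivative V') (at p)"
    unfolding V[abs_def] V'_def
    by (rule derivative_eq_intros AD BD JD refl)+
      (auto simp: cp[unfolded p] p fun_eq_iff inner_commute algebra_simps)
  have "snd (frame_coords p (profile_field \<theta> p)) = 0" by (simp add: profile_field_def Let_def)
  note tr = trace_frame[OF this, of V']
  have Jaxis: "Jrot (axis i 1) \<bullet> (r *\<^sub>R e) = - r * Jrot e $ i" for i
    by (subst Jrot_antisym) (simp add: inner_axis Jrot_linear)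
  have JJ: "(Jrot (axis i 1) :: real ^ ('n + 'n)) $ i = 0" for i
    using inner_Jrot_self[of "axis i 1 :: real ^ ('n + 'n)"] by (simp add: inner_axis)
  have sums: "(\<Sum>i\<in>UNIV. e $ i * e $ i) = 1" "(\<Sum>i\<in>UNIV. Jrot e $ i * e $ i) = 0"
    "(\<Sum>i\<in>UNIV. Jrot e $ i * Jrot e $ i) = 1"
    using e1 inner_Jrot_Jrot[of e e] inner_Jrot_self[of e] by (simp_all add: inner_vec_def)
  have "fst (V' (axis i 1, Jrot (axis i 1) \<bullet> fst p)) $ i
      = (r\<^sup>2 * A' (0, 1)) * (Jrot e $ i * Jrot e $ i) + (r\<^sup>2 * B' (0, 1) - r * A' (1, 0)) * (Jrot e $ i * e $ i)
        - (r * B' (1, 0)) * (e $ i * e $ i) - B (r, \<tau>)" for i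
    unfolding V'_def p fst_conv snd_conv Jaxis A(3)[of "_ \<bullet> _"] B(3)[of "_ \<bullet> _"]
    by (simp add: JJ inner_axis Jrot_linear algebra_simps power2_eq_square)
  then have "(\<Sum>i\<in>UNIV. fst (V' (axis i 1, Jrot (axis i 1) \<bullet> fst p)) $ i)
     = r\<^sup>2 * A' (0, 1) - r * B' (1, 0) - 2 * real CARD('n) * B (r, \<tau>)"
    by (simp add: sum.distrib sum_subtractf sum_distrib_left[symmetric] sums)
  moreover have "snd (V' (0, 1)) - Jrot (fst (V' (0, 1))) \<bullet> fst p = 0"
    by (simp add: V'_def p Jrot_linear Jrot_Jrot inner_simps inner_Jrot_self e1 power2_eq_square)
  ultimately have "(\<Sum>b\<in>Basis. frame_coords p (V' (of_frame p b) + heis_chr p (of_frame p b) (profile_field \<theta> p)) \<bullet> b)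
    = r\<^sup>2 * A' (0, 1) - r * B' (1, 0) - 2 * real CARD('n) * B (r, \<tau>)"
    unfolding tr by simp
  also have "\<dots> = r\<^sup>2 * \<theta>' (sin a, cos a) / horizontal_length r a ^ 3 + r * (sin a)\<^sup>2 * cos a / horizontal_length r a ^ 3
      - (2 * real CARD('n) - 1) * cos a / (r * horizontal_length r a)"
    unfolding At mult.commute[of r "B' (1, 0)"] Br T(3)[of "sin a"] B_def fst_conv a[symmetric] Y_def
    by (simp add: field_simps add_divide_distrib diff_divide_distrib)
  finally show ?thesis using VD by (rule that[rotated])
qed

section \<open>The equation of the generating curve\<close>

text \<open>
  On \<open>S\<close> the horizontal normal coincides with \<open>profile_field \<theta>\<close> near the point, so its divergence is given
  by \<open>profile_field_trace\<close>. Along the curve the angle is \<open>\<theta>\<close>, so that its derivative is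
  \<open>\<theta>' (sin a, cos a)\<close>.
\<close>

lemma angle_ode_interior:
  fixes S :: "'n::finite heis set"
  assumes C2: "C2_hypersurface S" and S: "rotation_invariant S"
    and gen: "generating_curve k S I x t dx dt" and ang: "angle_function I dx dt \<sigma>"
    and N: "unit_normal S N" and prof: "has_profile_normal N I x t dx dt"
    and H: "has_constant_mean_curvature S N H"
    and s0: "s0 \<in> interior I" "x s0 > 0"
  shows "(\<sigma> has_real_derivative sigma_rhs CARD('n) H (x s0) (\<sigma> s0)) (at s0)"
proof -
  have sI: "s0 \<in> I" using s0(1) interior_subset by blast
  have conn: "connected I" using gen by (simp add: generating_curve_def is_interval_connected)
  have "I \<noteq> {s}" for s using s0(1) by auto
  then have lim: "s islimpt I" if "s \<in> I" for s by (rule connected_imp_perfect[OF conn that])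
  define e :: "real ^ ('n + 'n)" where "e = axis (Inl k) 1"
  have e: "norm e = 1" by (simp add: e_def)
  define a where "a = \<sigma> s0"
  define p where "p = (x s0 *\<^sub>R e, t s0)"
  obtain \<theta> W where W: "open W" "(x s0, t s0) \<in> W"
    and \<theta>d: "\<theta> differentiable (at (x s0, t s0))" and \<theta>0: "\<theta> (x s0, t s0) = \<sigma> s0"
    and sc: "\<And>s. s \<in> I \<Longrightarrow> (x s, t s) \<in> W \<Longrightarrow>
        sin (\<sigma> s) = sin (\<theta> (x s, t s)) \<and> cos (\<sigma> s) = cos (\<theta> (x s, t s))"
    and \<sigma>\<theta>: "\<forall>\<^sub>F s in at s0 within I. \<sigma> s = \<theta> (x s, t s)"
    by (rule angle_field_exists[OF C2 S gen ang N prof lim sI s0(2)]) (assumption, rule that)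
  have dx: "dx s = sin (\<sigma> s)" "dt s = cos (\<sigma> s)" if "s \<in> I" for s
    using ang that by (simp_all add: angle_function_def)
  obtain \<theta>' where \<theta>': "(\<theta> has_derivative \<theta>') (at (x s0, t s0))"
    using \<theta>d by (auto simp: differentiable_def)
  define V where "V = (profile_field \<theta> :: 'n heis \<Rightarrow> 'n heis)"
  obtain V' where V': "(V has_derivative V') (at p)"
    and tr: "(\<Sum>b\<in>Basis. frame_coords p (V' (of_frame p b) + heis_chr p (of_frame p b) (V p)) \<bullet> b)
     = (x s0)\<^sup>2 * \<theta>' (sin a, cos a) / horizontal_length (x s0) a ^ 3
      + x s0 * (sin a)\<^sup>2 * cos a / horizontal_length (x s0) a ^ 3
      - (2 * real CARD('n) - 1) * cos a / (x s0 * horizontal_length (x s0) a)"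
    unfolding V_def
    by (rule profile_field_trace[OF \<theta>' s0(2) e _ p_def, of a]) (simp_all add: a_def \<theta>0)
  define W' where "W' = {q :: 'n heis. (norm (fst q), snd q) \<in> W \<and> fst q \<noteq> 0}"
  have "open W'"
  proof -
    have "W' = (\<lambda>q. (norm (fst q), snd q)) -` W \<inter> {q. fst q \<noteq> 0}" by (auto simp: W'_def)
    moreover have "open ((\<lambda>q :: 'n heis. (norm (fst q), snd q)) -` W)"
      by (rule open_vimage[OF W(1)]) (intro continuous_intros)
    moreover have "open {q :: 'n heis. fst q \<noteq> 0}"
      by (intro open_Collect_neq continuous_intros)
    ultimately show ?thesis by (simp add: open_Int)
  qed
  have pW: "p \<in> W'" using W(2) s0(2) e by (auto simp: W'_def p_def)
  have UV: "horizontal_normal N q = V q" if q: "q \<in> S" "q \<in> W'" for q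
  proof -
    obtain s where s: "s \<in> I" "x s = norm (fst q)" "t s = snd q"
      using q(1) generating_curve_mem_iff[OF S gen, of "fst q" "snd q"] by auto
    have x: "x s > 0" using q(2) s(2) by (simp add: W'_def)
    have "(x s, t s) \<in> W" using q(2) s by (simp add: W'_def)
    \<comment> \<open>The parameter \<open>s\<close> need not be near \<open>s0\<close>; only its point in the half-plane is.\<close>
    note sc = sc[OF s(1) this]
    have "horizontal_normal N (fst q, t s) = profile_field \<theta> (fst q, t s)"
      by (rule horizontal_normal_profile[OF prof s(1) x generating_curveD(3)[OF gen s(1)]])
        (use sc dx[OF s(1)] s in simp_all)
    then show ?thesis by (simp add: s(3) V_def)
  qed
  have pS: "p \<in> S"
    using sI s0(2) e unfolding p_def generating_curve_mem_iff[OF S gen] by (intro bexI[of _ s0]) simp_all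
  have n1: "metric p (N p) (N p) = 1"
    using N pS by (simp add: unit_normal_def metric_norm_def)
  have V1: "metric q (V q) (V q) = 1" if "q \<in> W'" for q
    unfolding V_def using that by (intro profile_field_unit) (simp add: W'_def)
  have fV: "fst (V p) = (1 / norm (fst (N p))) *\<^sub>R fst (N p)"
    unfolding UV[OF pS pW, symmetric] horizontal_normal_eq by simp
  have "p \<notin> singular_set S N"
  proof
    assume "p \<in> singular_set S N"
    then have "V p = of_frame p (0, 0)"
      unfolding UV[OF pS pW, symmetric] horizontal_normal_eq by (simp add: singular_set_iff)
    then show False using V1[OF pW] by (simp add: metric_def)
  qed
  then have "mean_curvature S N p = H"
    using H pS by (simp add: has_constant_mean_curvature_def)
  then have "divergence S (horizontal_normal N) p = - 2 * real CARD('n) * H"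
    by (simp add: mean_curvature_def field_simps)
  moreover have "metric p (V' (N p) + heis_chr p (N p) (V p)) (N p) = 0"
  proof (rule normal_term_zero[OF V' \<open>open W'\<close> pW V1])
    show "fst (N p) = norm (fst (N p)) *\<^sub>R fst (V p)" by (simp add: fV)
  qed (simp_all add: V_def profile_field_horizontal)
  moreover have "tangent_space S p = {v. metric p (N p) v = 0}"
    by (rule tangent_space_at_profile[OF S gen N prof s0]) (simp add: p_def e_def)
  ultimately have "(x s0)\<^sup>2 * \<theta>' (sin a, cos a) / horizontal_length (x s0) a ^ 3
      + x s0 * (sin a)\<^sup>2 * cos a / horizontal_length (x s0) a ^ 3
      - (2 * real CARD('n) - 1) * cos a / (x s0 * horizontal_length (x s0) a) = - 2 * real CARD('n) * H"
    using divergence_eq_trace[OF pS _ n1 V' \<open>open W'\<close> pW UV] tr by simp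
  then have rhs: "\<theta>' (sin a, cos a) = sigma_rhs CARD('n) H (x s0) a"
    using sigma_rhs_iff[OF s0(2)] by blast
  have at: "at s0 within I = at s0" using s0(1) by (rule at_within_interior)
  have "((\<lambda>s. (x s, t s)) has_derivative (\<lambda>h. h *\<^sub>R (sin a, cos a))) (at s0)"
    using generating_curveD(1,2)[OF gen sI] unfolding at dx[OF sI]
    by (intro has_vector_derivative_Pair[unfolded has_vector_derivative_def])
      (simp_all add: has_field_derivative_def a_def mult.commute[of _ "sin _"] mult.commute[of _ "cos _"])
  from has_derivative_compose[OF this \<theta>']
  have "((\<lambda>s. \<theta> (x s, t s)) has_derivative (\<lambda>h. h * \<theta>' (sin a, cos a))) (at s0)"
    using linear_cmul[OF has_derivative_linear[OF \<theta>'], of _ "(sin a, cos a)"] by simp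
  then have "(\<sigma> has_derivative (\<lambda>h. h * \<theta>' (sin a, cos a))) (at s0)"
    by (rule has_derivative_transform_eventually)
      (use \<sigma>\<theta> \<theta>0 in \<open>auto simp: at elim: eventually_mono\<close>)
  then show ?thesis
    unfolding rhs by (simp add: has_field_derivative_def a_def mult.commute[of _ "sigma_rhs _ _ _ _"])
qed

lemma cmc_system_at_profile:
  fixes S :: "'n::finite heis set"
  assumes C2: "C2_hypersurface S" and S: "rotation_invariant S"
    and gen: "generating_curve k S I x t dx dt" and ang: "angle_function I dx dt \<sigma>"
    and N: "unit_normal S N" and prof: "has_profile_normal N I x t dx dt"
    and H: "has_constant_mean_curvature S N H"
    and s0: "s0 \<in> I" "x s0 > 0"
  shows "cmc_system_at CARD('n) H I x t \<sigma> s0"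
proof -
  note D = generating_curveD(1,2)[OF gen s0(1)]
  have \<sigma>: "continuous_on I \<sigma>" and dx: "dx s0 = sin (\<sigma> s0)" "dt s0 = cos (\<sigma> s0)"
    using ang s0(1) by (simp_all add: angle_function_def)
  have xc: "(x \<longlongrightarrow> x s0) (at s0 within I)"
    using DERIV_continuous[OF D(1)] by (simp add: continuous_within)
  have \<sigma>c: "(\<sigma> \<longlongrightarrow> \<sigma> s0) (at s0 within I)"
    using \<sigma> s0(1) by (simp add: continuous_on)
  have "(x s0)\<^sup>2 * (sin (\<sigma> s0))\<^sup>2 + (cos (\<sigma> s0))\<^sup>2 \<noteq> 0"
    using horizontal_length_pos[of "x s0" "\<sigma> s0"] s0(2) by (auto simp: horizontal_length_def)
  then have "continuous (at s0 within I) (\<lambda>s. sigma_rhs CARD('n) H (x s) (\<sigma> s))"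
    unfolding sigma_rhs_def continuous_within using s0(2)
    by (intro tendsto_intros xc \<sigma>c) simp_all
  moreover have "\<forall>\<^sub>F s in at s0. s \<in> interior I \<longrightarrow>
      (\<sigma> has_real_derivative sigma_rhs CARD('n) H (x s) (\<sigma> s)) (at s)"
  proof -
    have "\<forall>\<^sub>F s in at s0 within I. x s > 0" using xc s0(2) by (rule order_tendstoD)
    then have "\<forall>\<^sub>F s in at s0. s \<in> I \<longrightarrow> x s > 0"
      unfolding eventually_at_filter by eventually_elim simp
    then show ?thesis
      by eventually_elim (use angle_ode_interior[OF C2 S gen ang N prof H] interior_subset[of I] in blast)
  qed
  ultimately have "(\<sigma> has_real_derivative sigma_rhs CARD('n) H (x s0) (\<sigma> s0)) (at s0 within I)"
    using gen \<sigma> s0(1) by (intro derivative_extends_to_interval) (simp_all add: generating_curve_def)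
  then show ?thesis using D by (simp add: cmc_system_at_iff dx)
qed

theorem lemma5p1:
  fixes H :: real
  shows
    "(\<forall>(S :: 'n::finite heis set) N k I x t dx dt \<sigma>.
        C2_hypersurface S \<and> rotation_invariant S \<and>
        generating_curve k S I x t dx dt \<and> angle_function I dx dt \<sigma> \<and>
        unit_normal S N \<and> has_profile_normal N I x t dx dt \<and>
        has_constant_mean_curvature S N H \<longrightarrow>
        (\<forall>s\<in>I. x s > 0 \<longrightarrow> cmc_system_at CARD('n) H I x t \<sigma> s))
   \<and> (\<forall>J x t \<sigma>.
        is_interval J \<and> (\<forall>s\<in>J. x s > 0 \<and> cmc_system_at CARD('n) H J x t \<sigma> s) \<longrightarrow>
        (\<lambda>s. x s ^ (2 * CARD('n) - 1) * cos (\<sigma> s)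
               / sqrt ((x s)\<^sup>2 * (sin (\<sigma> s))\<^sup>2 + (cos (\<sigma> s))\<^sup>2)
             - H * x s ^ (2 * CARD('n))) constant_on J)"
proof (intro conjI allI impI ballI)
  fix S :: "'n heis set" and N k I x t dx dt \<sigma> s
  assume "C2_hypersurface S \<and> rotation_invariant S \<and>
        generating_curve k S I x t dx dt \<and> angle_function I dx dt \<sigma> \<and>
        unit_normal S N \<and> has_profile_normal N I x t dx dt \<and>
        has_constant_mean_curvature S N H"
    and "s \<in> I" "x s > 0"
  then show "cmc_system_at CARD('n) H I x t \<sigma> s" by (elim conjE) (rule cmc_system_at_profile)
next
  fix J and x t \<sigma> :: "real \<Rightarrow> real"
  assume "is_interval J \<and> (\<forall>s\<in>J. x s > 0 \<and> cmc_system_at CARD('n) H J x t \<sigma> s)"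
  then show "(\<lambda>s. x s ^ (2 * CARD('n) - 1) * cos (\<sigma> s)
               / sqrt ((x s)\<^sup>2 * (sin (\<sigma> s))\<^sup>2 + (cos (\<sigma> s))\<^sup>2)
             - H * x s ^ (2 * CARD('n))) constant_on J"
    by (intro first_integral[of _ J x H t]) (auto simp: one_le_card_finite)
qed

end
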